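(* Let $\mathbb{K}$ be a field, let $n$ be a non-negative integer, and let $\mathcal{S}$ be a $\mathbb{K}$-linear subspace of $\mathrm{A}_n(\mathbb{K})$ whose codimension in $\mathrm{A}_n(\mathbb{K})$ satisfies $\operatorname{codim} \mathcal{S} \leq n-3$. Then every range-compatible homomorphism $F : \mathcal{S} \to \mathbb{K}^n$ is local.
   Context: $\mathbb{K}$ is an arbitrary field. $\mathrm{A}_n(\mathbb{K})$ denotes the space of all $n \times n$ alternating matrices with entries in $\mathbb{K}$, i.e. matrices $M$ with $X^T M X = 0$ for all $X \in \mathbb{K}^n$ (equivalently, skew-symmetric with zero diagonal); each such matrix is identified with a linear map $\mathbb{K}^n \to \mathbb{K}^n$, $X \mapsto MX$. "Homomorphism" means group homomorphism for addition (additive map); it is not assumed $\mathbb{K}$-linear. A map $F : \mathcal{S} \to \mathbb{K}^n$ is range-compatible when $F(M) \in \operatorname{Im} M$ (the column space of $M$) for all $M \in \mathcal{S}$. It is local when there exists $X \in \mathbb{K}^n$ such that $F(M) = MX$ for all $M \in \mathcal{S}$. *)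

theory Defs
  imports "HOL-Analysis.Cartesian_Space"
begin

definition mat_scale :: "'a::field \<Rightarrow> 'a^'m^'n \<Rightarrow> 'a^'m^'n"
  where "mat_scale c M = (\<chi> i j. c * M $ i $ j)"

global_interpretation mat: vector_space "mat_scale :: 'a::field \<Rightarrow> 'a^'m^'n \<Rightarrow> 'a^'m^'n"
  by unfold_locales (simp_all add: mat_scale_def vec_eq_iff algebra_simps)

definition alternating :: "'a::field^'n^'n \<Rightarrow> bool"
  where "alternating M \<longleftrightarrow> (\<forall>X. scalar_product X (M *v X) = 0)"

definition alternating_mats :: "('a::field^'n^'n) set"
  where "alternating_mats = {M. alternating M}"

text \<open>Integer-valued, so that a bound of the form \<open>n - 3\<close> is not truncated at 0 for small \<open>n\<close>.
  It is the codimension only for linear subspaces of \<open>alternating_mats\<close>.\<close>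

definition alt_codim :: "('a::field^'n^'n) set \<Rightarrow> int"
  where "alt_codim S = int (mat.dim (alternating_mats :: ('a^'n^'n) set)) - int (mat.dim S)"

text \<open>In the following, only the values of \<open>F\<close> on \<open>S\<close> matter; \<open>F\<close> stands for a map from
  \<open>S\<close> to \<open>'a^'n\<close>.\<close>

definition additive_on :: "('a::field^'n^'n) set \<Rightarrow> ('a^'n^'n \<Rightarrow> 'a^'n) \<Rightarrow> bool"
  where "additive_on S F \<longleftrightarrow> (\<forall>A\<in>S. \<forall>B\<in>S. F (A + B) = F A + F B)"

definition range_compatible :: "('a::field^'n^'n) set \<Rightarrow> ('a^'n^'n \<Rightarrow> 'a^'n) \<Rightarrow> bool"
  where "range_compatible S F \<longleftrightarrow> (\<forall>M\<in>S. F M \<in> range (\<lambda>X. M *v X))"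

definition local_on :: "('a::field^'n^'n) set \<Rightarrow> ('a^'n^'n \<Rightarrow> 'a^'n) \<Rightarrow> bool"
  where "local_on S F \<longleftrightarrow> (\<exists>X. \<forall>M\<in>S. F M = M *v X)"

end

theory Submission
  imports Defs
begin

text \<open>
  View an alternating matrix as a bilinear form. If \<open>p \<and> q\<close> ranges over the rank-two elements of \<open>S\<close>
  with a fixed first factor \<open>p\<close>, the codimension bound leaves at least two dimensions for \<open>q\<close> modulo
  \<open>p\<close>, so range compatibility forces \<open>F (p \<and> q)\<close> to be a fixed multiple of \<open>q\<close> modulo \<open>p\<close>. Subtracting a local
  map makes this multiple zero, and \<open>F\<close> modulo \<open>p\<close> then depends only on the restriction of the forms
  to the hyperplane of \<open>p\<close>. The induced map need not be range-compatible: it may fail at kernel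
  vectors in a subspace \<open>B\<close>. Its dimension is exactly the drop in codimension, so the theorem is
  proved by induction on the dimension for maps that are range-compatible off \<open>B\<close>, under the bounds
  \<open>codim S \<le> n - 3\<close> and \<open>codim S + dim B \<le> n - 2\<close>. Finally, the local models obtained modulo three
  independent functionals \<open>p\<close> are compared; if they disagreed, \<open>S\<close> would be too small.
\<close>

section \<open>Annihilators and wedge products\<close>

abbreviation dot :: "'a::field^'n \<Rightarrow> 'a^'n \<Rightarrow> 'a" (infixl "\<cdot>" 70)
  where "x \<cdot> y \<equiv> scalar_product x y"

text \<open>Vectors double as functionals through the dot product, so one operator serves
  annihilators on both sides. Over a general field \<open>X\<close> may meet \<open>ann X\<close>,
  so this is not an orthogonal complement.\<close>

definition ann :: "('a::field^'n) set \<Rightarrow> ('a^'n) set"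
  where "ann X = {v. \<forall>u\<in>X. u \<cdot> v = 0}"

definition wedge :: "'a::field^'n \<Rightarrow> 'a^'n \<Rightarrow> 'a^'n^'n"
  where "wedge p q = (\<chi> i j. p $ i * q $ j - q $ i * p $ j)"

lemma dot_commute: "x \<cdot> y = y \<cdot> x"
  by (simp add: scalar_product_def mult.commute)

lemma dot_simps [simp]:
  "0 \<cdot> y = 0" "x \<cdot> 0 = 0"
  "(x + x') \<cdot> y = x \<cdot> y + x' \<cdot> y" "x \<cdot> (y + y') = x \<cdot> y + x \<cdot> y'"
  "(x - x') \<cdot> y = x \<cdot> y - x' \<cdot> y" "x \<cdot> (y - y') = x \<cdot> y - x \<cdot> y'"
  "(- x) \<cdot> y = - (x \<cdot> y)" "x \<cdot> (- y) = - (x \<cdot> y)"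
  "(c *s x) \<cdot> y = c * (x \<cdot> y)" "x \<cdot> (c *s y) = c * (x \<cdot> y)"
  by (simp_all add: scalar_product_def algebra_simps sum.distrib sum_distrib_left sum_subtractf sum_negf)

lemma annD: "v \<in> ann X \<Longrightarrow> u \<in> X \<Longrightarrow> u \<cdot> v = 0"
  by (simp add: ann_def)

lemma subspace_ann [simp]: "vec.subspace (ann X)"
  by (auto simp: vec.subspace_def ann_def)

lemma ann_span: "ann (vec.span X) = ann X"
proof
  show "ann X \<subseteq> ann (vec.span X)"
  proof
    fix v assume v: "v \<in> ann X"
    have "u \<cdot> v = 0" if "u \<in> vec.span X" for u
      using that v by (induction rule: vec.span_induct_alt) (auto simp: ann_def)
    then show "v \<in> ann (vec.span X)" by (simp add: ann_def)
  qed
qed (auto simp: ann_def vec.span_base)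

lemma wedge_mult: "wedge p q *v x = (q \<cdot> x) *s p - (p \<cdot> x) *s q"
  by (simp add: vec_eq_iff wedge_def matrix_vector_mult_def scalar_product_def
      algebra_simps sum.distrib sum_subtractf sum_distrib_left)

lemma wedge_linear_simps:
  "wedge p (q + q') = wedge p q + wedge p q'" "wedge p (c *s q) = mat_scale c (wedge p q)"
  "wedge (p + p') q = wedge p q + wedge p' q" "wedge (c *s p) q = mat_scale c (wedge p q)"
  by (simp_all add: wedge_def mat_scale_def vec_eq_iff algebra_simps)

lemma wedge_alternating [simp]: "wedge p q \<in> alternating_mats"
  by (simp add: alternating_mats_def alternating_def wedge_mult dot_commute)

lemma mat_scale_mult: "mat_scale c M *v x = c *s (M *v x)"
  by (simp add: vec_eq_iff mat_scale_def matrix_vector_mult_def sum_distrib_left algebra_simps)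

lemma alternating_skew:
  assumes "M \<in> alternating_mats"
  shows "u \<cdot> (M *v v) = - (v \<cdot> (M *v u))"
proof -
  have "x \<cdot> (M *v x) = 0" for x
    using assms by (simp add: alternating_mats_def alternating_def)
  from this[of "u + v"] this[of u] this[of v] show ?thesis
    by (simp add: matrix_vector_right_distrib add_eq_0_iff)
qed

lemma subspace_alternating [simp]: "mat.subspace alternating_mats"
  by (auto simp: mat.subspace_def alternating_mats_def alternating_def
      matrix_vector_mult_add_rdistrib mat_scale_mult)

section \<open>Duality between subspaces and their annihilators\<close>

lemma separate_from_subspace:
  fixes X :: "('a::field^'n) set"
  assumes "vec.subspace X" "v \<notin> X"
  obtains u where "u \<in> ann X" "u \<cdot> v = 1"
proof -
  obtain B where B: "B \<subseteq> X" "vec.independent B" "X \<subseteq> vec.span B" "card B = vec.dim X"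
    using vec.basis_exists[of X] by blast
  have "v \<notin> vec.span B" using B assms vec.span_minimal by blast
  then have ind: "vec.independent (insert v B)" using B by (simp add: vec.independent_insert)
  \<comment> \<open>The functional sought is scalar, but the extension is made for maps into
    \<open>'a^'n\<close>; the arbitrary coordinate \<open>undefined\<close> carries its
    value.\<close>
  define f :: "'a^'n \<Rightarrow> 'a^'n" where "f = (\<lambda>x. if x = v then axis undefined 1 else 0)"
  obtain g where g: "Vector_Spaces.linear (*s) (*s) g" "\<forall>x\<in>insert v B. g x = f x"
    using vec.linear_independent_extend[OF ind, of f] by blast
  interpret g: Vector_Spaces.linear "(*s)" "(*s)" g by (rule g(1))
  define u :: "'a^'n" where "u = (\<chi> i. g (axis i 1) $ undefined)"
  have u: "u \<cdot> x = g x $ undefined" for x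
  proof -
    have "g x = g (\<Sum>i\<in>UNIV. x $ i *s axis i 1)"
      by (simp add: basis_expansion)
    also have "\<dots> = (\<Sum>i\<in>UNIV. x $ i *s g (axis i 1))"
      by (simp add: g.sum g.scale)
    finally show ?thesis
      by (simp add: u_def scalar_product_def mult.commute)
  qed
  have "u \<cdot> x = 0" if "x \<in> B" for x
    using that g \<open>v \<notin> vec.span B\<close> vec.span_base[of x B] by (auto simp: u f_def)
  then have "u \<in> ann B" by (auto simp: ann_def dot_commute)
  then have "u \<in> ann (vec.span B)" by (simp add: ann_span)
  then have "u \<in> ann X" using B by (auto simp: ann_def)
  moreover have "u \<cdot> v = 1" using g by (simp add: u f_def axis_def)
  ultimately show thesis by (rule that)
qed

lemma ann_ann:
  assumes "vec.subspace X"
  shows "ann (ann X) = X"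
proof
  show "X \<subseteq> ann (ann X)" by (auto simp: ann_def dot_commute)
  show "ann (ann X) \<subseteq> X"
  proof
    fix v assume v: "v \<in> ann (ann X)"
    show "v \<in> X"
    proof (rule ccontr)
      assume "v \<notin> X"
      from separate_from_subspace[OF assms this] obtain u where "u \<in> ann X" "u \<cdot> v = 1" .
      with v show False by (auto simp: ann_def)
    qed
  qed
qed

lemma dim_hyperplane_section:
  assumes "vec.subspace X" "x \<in> X" "v \<cdot> x \<noteq> 0"
  shows "vec.dim X = vec.dim (X \<inter> ann {v}) + 1"
proof -
  have sub: "vec.subspace (X \<inter> ann {v})" using assms(1) by (simp add: vec.subspace_inter)
  have "y \<in> vec.span (insert x (X \<inter> ann {v}))" if "y \<in> X" for y
  proof -
    let ?k = "(v \<cdot> y) / (v \<cdot> x)"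
    have "y - ?k *s x \<in> X \<inter> ann {v}"
      using that assms by (auto simp: ann_def vec.subspace_diff vec.subspace_scale)
    then show ?thesis unfolding vec.span_breakdown_eq by (blast intro: vec.span_base)
  qed
  moreover have "vec.span (insert x (X \<inter> ann {v})) \<subseteq> X"
    using assms by (intro vec.span_minimal) auto
  ultimately have "vec.span (insert x (X \<inter> ann {v})) = X" by blast
  then have "vec.dim X = vec.dim (insert x (X \<inter> ann {v}))" by (metis vec.dim_span)
  moreover have "x \<notin> vec.span (X \<inter> ann {v})"
    using assms sub by (simp add: vec.span_eq_iff[THEN iffD2] ann_def)
  ultimately show ?thesis by (simp add: vec.dim_insert)
qed

text \<open>Induction over a basis: the separating functional \<open>u\<close> lies in
  \<open>ann B\<close> but not in \<open>ann {v}\<close>, so each basis vector cuts the annihilator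
  by exactly one dimension.\<close>

lemma dim_ann:
  fixes X :: "('a::field^'n) set"
  shows "vec.dim (ann X) + vec.dim X = CARD('n)"
proof -
  have *: "vec.dim (ann B) + card B = CARD('n)" if "finite B" "vec.independent B" for B :: "('a^'n) set"
    using that
  proof (induction rule: finite_induct)
    case empty
    have "ann {} = (UNIV :: ('a^'n) set)" by (auto simp: ann_def)
    then show ?case by (simp add: card_cart_basis)
  next
    case (insert v B)
    then have ind: "vec.independent B" "v \<notin> vec.span B"
      by (simp_all add: vec.independent_insert)
    from separate_from_subspace[OF vec.subspace_span ind(2)]
    obtain u where u: "u \<in> ann (vec.span B)" "u \<cdot> v = 1" .
    have "vec.dim (ann B) = vec.dim (ann B \<inter> ann {v}) + 1"
      by (rule dim_hyperplane_section[of _ u]) (use u in \<open>auto simp: ann_span dot_commute\<close>)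
    moreover have "ann B \<inter> ann {v} = ann (insert v B)" by (auto simp: ann_def)
    ultimately show ?case using insert ind by simp
  qed
  obtain B where B: "B \<subseteq> X" "vec.independent B" "X \<subseteq> vec.span B" "card B = vec.dim X"
    using vec.basis_exists[of X] by blast
  then have "vec.span X = vec.span B"
    by (metis vec.span_mono vec.span_span subset_antisym)
  then have "ann X = ann B" by (metis ann_span)
  with * B show ?thesis using vec.finiteI_independent by metis
qed

text \<open>The complement of a proper subspace spans: if \<open>k\<close> lies outside
  \<open>B\<close> and \<open>u\<close> inside, then \<open>u = (k + u) - k\<close> with both terms
  outside. So exceptions in \<open>B\<close> are harmless as soon as \<open>B\<close> does not
  contain all of \<open>K\<close>.\<close>

lemma span_avoiding_subspace:
  assumes "vec.subspace K" "\<not> K \<subseteq> B" "vec.subspace B"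
    and "\<And>u. u \<in> K \<Longrightarrow> u \<notin> B \<Longrightarrow> u \<cdot> f = 0"
  shows "f \<in> ann K"
proof -
  obtain k where k: "k \<in> K" "k \<notin> B" using assms(2) by blast
  have "u \<cdot> f = 0" if "u \<in> K" for u
  proof (cases "u \<in> B")
    case True
    then have "k + u \<notin> B" using k assms(3) vec.subspace_diff[of B "k + u" u] by auto
    moreover have "k + u \<in> K" using k that assms(1) by (simp add: vec.subspace_add)
    ultimately have "(k + u) \<cdot> f = 0" "k \<cdot> f = 0" using assms(4) k by blast+
    then show ?thesis by simp
  qed (use assms(4) that in blast)
  then show ?thesis by (simp add: ann_def)
qed

section \<open>Dimensions of matrix spaces\<close>

definition unit_mats :: "('a::field^'m^'n) set"
  where "unit_mats = (\<lambda>(i, j). axis i (axis j 1)) ` UNIV"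

lemma mat_sum_component: "(\<Sum>x\<in>X. f x) $ i $ j = (\<Sum>x\<in>X. f x $ i $ j)"
  by simp

interpretation mat: finite_dimensional_vector_space
  "mat_scale :: 'a::field \<Rightarrow> 'a^'m^'n \<Rightarrow> 'a^'m^'n" unit_mats
proof
  show "finite (unit_mats :: ('a^'m^'n) set)" by (simp add: unit_mats_def)
  show "mat.independent (unit_mats :: ('a^'m^'n) set)"
  proof (rule mat.independent_if_scalars_zero)
    fix f :: "'a^'m^'n \<Rightarrow> 'a" and x :: "'a^'m^'n"
    assume *: "(\<Sum>x\<in>unit_mats. mat_scale (f x) x) = 0" and x: "x \<in> unit_mats"
    obtain i :: 'n and j :: 'm where ij: "x = axis i (axis j 1)" using x by (auto simp: unit_mats_def)
    have entry: "y $ i $ j = (if y = x then 1 else 0)" if "y \<in> unit_mats" for y :: "'a^'m^'n"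
      using that by (auto simp: unit_mats_def ij axis_def vec_eq_iff split: if_splits)
    have "(\<Sum>y\<in>unit_mats. mat_scale (f y) y) $ i $ j = (\<Sum>y\<in>unit_mats. if y = x then f y else 0)"
      unfolding mat_sum_component by (intro sum.cong) (simp_all add: mat_scale_def entry)
    also have "\<dots> = f x" using x by (simp add: sum.delta unit_mats_def)
    finally show "f x = 0" using * by simp
  qed (simp add: unit_mats_def)
  show "mat.span (unit_mats :: ('a^'m^'n) set) = UNIV"
  proof -
    have "M \<in> mat.span unit_mats" for M :: "'a^'m^'n"
    proof -
      have "(\<Sum>i\<in>UNIV. \<Sum>j\<in>UNIV. mat_scale (M $ i $ j) (axis i (axis j 1))) $ k $ l = M $ k $ l" for k l
      proof -
        have "mat_scale c (axis i (axis j 1)) $ k $ l = (if i = k then if j = l then c else 0 else 0)" for c :: 'a and i j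
          by (simp add: mat_scale_def axis_def)
        moreover have "(\<Sum>j\<in>UNIV. if i = k then if j = l then M $ i $ j else 0 else 0) = (if i = k then M $ i $ l else 0)" for i
          by (simp add: sum.delta)
        ultimately show ?thesis by (simp add: sum.delta)
      qed
      then have "M = (\<Sum>i\<in>UNIV. \<Sum>j\<in>UNIV. mat_scale (M $ i $ j) (axis i (axis j 1)))"
        by (simp add: vec_eq_iff)
      also have "\<dots> \<in> mat.span unit_mats"
        by (intro mat.span_sum mat.span_scale mat.span_base) (force simp: unit_mats_def)
      finally show ?thesis .
    qed
    then show ?thesis by blast
  qed
qed

text \<open>Rank-nullity on a subspace: a linear right inverse \<open>g\<close> embeds the image in
  \<open>S\<close> as a complement of the kernel.\<close>

lemma (in finite_dimensional_vector_space_pair) dim_image_kernel: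
  assumes "Vector_Spaces.linear s1 s2 f" "vs1.subspace S"
  shows "vs1.dim S = vs2.dim (f ` S) + vs1.dim {x \<in> S. f x = 0}"
proof -
  interpret f: Vector_Spaces.linear s1 s2 f by (rule assms(1))
  interpret inv: finite_dimensional_vector_space_pair s2 B2 s1 B1 ..
  define K where "K = {x \<in> S. f x = 0}"
  have K: "vs1.subspace K"
    unfolding K_def using assms(2)
    by (intro vs1.subspaceI) (simp_all add: vs1.subspace_0 vs1.subspace_add vs1.subspace_scale f.add f.scale f.zero)
  obtain g where g: "g ` UNIV \<subseteq> S" "Vector_Spaces.linear s2 s1 g" "\<And>v. v \<in> f ` S \<Longrightarrow> f (g v) = v"
    using linear_exists_right_inverse_on[OF assms] by blast
  interpret g: Vector_Spaces.linear s2 s1 g by (rule g(2))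
  have fS: "vs2.subspace (f ` S)" by (rule f.subspace_image[OF assms(2)])
  define C where "C = g ` f ` S"
  have C: "vs1.subspace C" unfolding C_def by (rule g.subspace_image[OF fS])
  have "C \<subseteq> S" unfolding C_def using g(1) by blast
  have S_eq: "{x + y |x y. x \<in> K \<and> y \<in> C} = S"
  proof
    show "{x + y |x y. x \<in> K \<and> y \<in> C} \<subseteq> S"
      using \<open>C \<subseteq> S\<close> vs1.subspace_add[OF assms(2)] unfolding K_def by blast
    show "S \<subseteq> {x + y |x y. x \<in> K \<and> y \<in> C}"
    proof
      fix x assume x: "x \<in> S"
      have "x - g (f x) \<in> S" using g(1) x by (intro vs1.subspace_diff[OF assms(2)]) auto
      moreover have "f (x - g (f x)) = 0" using x by (simp add: f.diff g(3))
      ultimately have "x - g (f x) \<in> K" by (simp add: K_def)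
      moreover have "g (f x) \<in> C" using x by (simp add: C_def)
      moreover have "x = (x - g (f x)) + g (f x)" by simp
      ultimately show "x \<in> {x + y |x y. x \<in> K \<and> y \<in> C}" by blast
    qed
  qed
  have "K \<inter> C \<subseteq> {0}"
    by (auto simp: K_def C_def g(3) g.zero)
  then have Int: "vs1.dim (K \<inter> C) = 0"
    by (simp add: vs1.dim_eq_0)
  have "vs1.dim S = vs1.dim K + vs1.dim C"
    using vs1.dim_sums_Int[OF K C] unfolding S_eq Int by simp
  moreover have "inj_on g (vs2.span (f ` S))"
    unfolding vs2.span_eq_iff[THEN iffD2, OF fS] by (rule inj_on_inverseI[of _ f]) (rule g(3))
  then have "vs1.dim C = vs2.dim (f ` S)"
    unfolding C_def by (rule inv.dim_image_eq[OF g(2)])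
  ultimately show ?thesis by (simp add: K_def)
qed

interpretation mat_vec: finite_dimensional_vector_space_pair
  "mat_scale :: 'a::field \<Rightarrow> 'a^'n^'n \<Rightarrow> 'a^'n^'n" unit_mats
  "(*s) :: 'a \<Rightarrow> 'a^'n \<Rightarrow> 'a^'n" cart_basis ..

interpretation vec_mat: finite_dimensional_vector_space_pair
  "(*s) :: 'a::field \<Rightarrow> 'a^'n \<Rightarrow> 'a^'n" cart_basis
  "mat_scale :: 'a \<Rightarrow> 'a^'n^'n \<Rightarrow> 'a^'n^'n" unit_mats ..

text \<open>The entries on one side of the diagonal are the coefficients of \<open>M\<close> in
  wedges of unit vectors.\<close>

lemma alternating_subset_if_wedges:
  fixes Q :: "('a::field^'n^'n) set"
  assumes "mat.subspace Q" "\<And>p q. wedge p q \<in> Q"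
  shows "alternating_mats \<subseteq> Q"
proof
  fix M :: "'a^'n^'n" assume M: "M \<in> alternating_mats"
  \<comment> \<open>The index type carries no order; an injection into \<open>nat\<close> selects
    one of each two pairs \<open>(i, j)\<close> and \<open>(j, i)\<close>. Summing over both and
    halving would fail in characteristic two.\<close>
  obtain f :: "'n \<Rightarrow> nat" where f: "inj f"
    using finite_imp_inj_to_nat_seg[of "UNIV :: 'n set"] by auto
  have entry: "axis i 1 \<cdot> (N *v axis j 1) = N $ i $ j" for i j and N :: "'a^'n^'n"
    by (simp add: scalar_product_def matrix_vector_mult_def axis_def if_distrib[of "\<lambda>x. _ * x"]
        if_distrib[of "\<lambda>x. x * _"] cong: if_cong)
  have skew: "M $ i $ j = - M $ j $ i" and diag: "M $ i $ i = 0" for i j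
    using alternating_skew[OF M, of "axis i 1" "axis j 1"] M
    by (simp_all add: entry[symmetric] alternating_mats_def alternating_def)
  let ?c = "\<lambda>i j. if f i < f j then M $ i $ j else 0"
  have "M $ k $ l = (\<Sum>i\<in>UNIV. \<Sum>j\<in>UNIV. wedge (axis i 1) (?c i j *s axis j 1)) $ k $ l" for k l
  proof -
    have "wedge (axis i 1) (c *s axis j 1) $ k $ l =
        (if i = k then if j = l then c else 0 else 0) - (if i = l then if j = k then c else 0 else 0)"
      for i j :: 'n and c :: 'a by (auto simp: wedge_def axis_def)
    then have "(\<Sum>i\<in>UNIV. \<Sum>j\<in>UNIV. wedge (axis i 1) (?c i j *s axis j 1)) $ k $ l
        = (\<Sum>i\<in>UNIV. (\<Sum>j\<in>UNIV. if i = k then if j = l then ?c i j else 0 else 0)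
            - (\<Sum>j\<in>UNIV. if i = l then if j = k then ?c i j else 0 else 0))"
      by (simp only: mat_sum_component sum_subtractf)
    also have "\<dots> = (\<Sum>i\<in>UNIV. (if i = k then ?c i l else 0) - (if i = l then ?c i k else 0))"
    proof (rule sum.cong[OF refl])
      fix i
      have "(\<Sum>j\<in>UNIV. if i = a then if j = b then ?c i j else 0 else 0) = (if i = a then ?c i b else 0)" for a b
        by (cases "i = a") (simp_all only: if_True if_False sum.delta finite UNIV_I sum.neutral_const refl)
      then show "(\<Sum>j\<in>UNIV. if i = k then if j = l then ?c i j else 0 else 0)
            - (\<Sum>j\<in>UNIV. if i = l then if j = k then ?c i j else 0 else 0) = (if i = k then ?c i l else 0) - (if i = l then ?c i k else 0)"
        by (simp only:)
    qed
    also have "\<dots> = ?c k l - ?c l k"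
      by (simp only: sum_subtractf sum.delta finite UNIV_I if_True)
    also have "\<dots> = M $ k $ l"
      using skew[of k l] diag injD[OF f, of k l] by (cases "f k" "f l" rule: linorder_cases) auto
    finally show ?thesis by simp
  qed
  then have "M = (\<Sum>i\<in>UNIV. \<Sum>j\<in>UNIV. wedge (axis i 1) (?c i j *s axis j 1))"
    by (intro vec_eq_iff[THEN iffD2] allI)
  moreover have "(\<Sum>i\<in>UNIV. \<Sum>j\<in>UNIV. wedge (axis i 1) (?c i j *s axis j 1)) \<in> Q"
    by (intro mat.subspace_sum assms)
  ultimately show "M \<in> Q" by (rule ssubst)
qed

text \<open>The kernel of \<open>wedge p\<close> is the line of \<open>p\<close>, hence the
  \<open>+ 1\<close>.\<close>

lemma dim_wedge_image:
  fixes p :: "'a::field^'n"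
  assumes "vec.subspace L" "p \<in> L" "p \<noteq> 0"
  shows "vec.dim L = mat.dim (wedge p ` L) + 1"
proof -
  have lin: "Vector_Spaces.linear (*s) mat_scale (wedge p)"
    by (simp add: Vector_Spaces.linear_iff wedge_linear_simps vec.vector_space_axioms mat.vector_space_axioms)
  obtain i where i: "p $ i \<noteq> 0" using assms(3) by (auto simp: vec_eq_iff)
  have "q = (q $ i / p $ i) *s p" if "wedge p q = 0" for q
  proof -
    have "p $ i * q $ j = q $ i * p $ j" for j
      using that by (simp add: wedge_def vec_eq_iff)
    then show ?thesis using i by (simp add: vec_eq_iff field_simps)
  qed
  moreover have "wedge p (c *s p) = 0" for c
    by (simp add: wedge_def vec_eq_iff algebra_simps)
  ultimately have "{q \<in> L. wedge p q = 0} = vec.span {p}"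
    using assms by (auto simp: vec.span_singleton vec.subspace_scale)
  then have "vec.dim {q \<in> L. wedge p q = 0} = 1"
    using assms(3) by (simp add: vec.dim_insert)
  then show ?thesis using vec_mat.dim_image_kernel[OF lin assms(1)] by simp
qed

section \<open>Evaluation of alternating matrices at a vector\<close>

lemma linear_eval: "Vector_Spaces.linear mat_scale (*s) (\<lambda>M :: 'a::field^'n^'n. M *v x)"
  by (simp add: Vector_Spaces.linear_iff matrix_vector_mult_add_rdistrib mat_scale_mult vec.vector_space_axioms mat.vector_space_axioms)

lemma eval_alternating:
  assumes "x \<noteq> 0"
  shows "(\<lambda>M. M *v x) ` alternating_mats = ann {x}"
proof
  show "(\<lambda>M. M *v x) ` alternating_mats \<subseteq> ann {x}"
    by (auto simp: ann_def alternating_mats_def alternating_def)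
  show "ann {x} \<subseteq> (\<lambda>M. M *v x) ` alternating_mats"
  proof
    fix v assume "v \<in> ann {x}"
    moreover obtain q where "q \<cdot> x = 1"
      using separate_from_subspace[of "{0}" x] assms by auto
    ultimately have "wedge v q *v x = v"
      by (simp add: wedge_mult ann_def dot_commute)
    then show "v \<in> (\<lambda>M. M *v x) ` alternating_mats" by (metis imageI wedge_alternating)
  qed
qed

text \<open>Rank-nullity for evaluation at \<open>x\<close>, applied to all alternating matrices
  (with image \<open>ann {x}\<close>) and to \<open>T\<close>: the codimension of \<open>T\<close>
  splits into one for the images and one for the kernels. If the images already use up all of
  \<open>c\<close>, the kernels coincide.\<close>

lemma codim_eval:
  fixes T :: "('a::field^'n^'n) set"
  assumes "mat.subspace T" "T \<subseteq> alternating_mats" "x \<noteq> 0" "\<And>M. M \<in> T \<Longrightarrow> M *v x \<in> P"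
    and "mat.dim (alternating_mats :: ('a^'n^'n) set) \<le> mat.dim T + c"
  shows "CARD('n) \<le> vec.dim P + c + 1"
    and "CARD('n) = vec.dim P + c + 1 \<Longrightarrow> {M \<in> alternating_mats. M *v x = 0} \<subseteq> T"
proof -
  let ?A = "alternating_mats :: ('a^'n^'n) set"
  have "vec.dim {x} = 1" using assms(3) by (simp add: vec.dim_insert)
  then have A: "mat.dim ?A + 1 = CARD('n) + mat.dim {M \<in> ?A. M *v x = 0}"
    using mat_vec.dim_image_kernel[OF linear_eval subspace_alternating, of x]
      dim_ann[of "{x}"] unfolding eval_alternating[OF assms(3)] by simp
  have T: "mat.dim T = vec.dim ((\<lambda>M. M *v x) ` T) + mat.dim {M \<in> T. M *v x = 0}"
    by (rule mat_vec.dim_image_kernel[OF linear_eval assms(1)])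
  have P: "vec.dim ((\<lambda>M. M *v x) ` T) \<le> vec.dim P"
    using assms(4) by (intro vec.dim_subset) auto
  have sub: "{M \<in> T. M *v x = 0} \<subseteq> {M \<in> ?A. M *v x = 0}" using assms(2) by blast
  then have K: "mat.dim {M \<in> T. M *v x = 0} \<le> mat.dim {M \<in> ?A. M *v x = 0}"
    by (rule mat.dim_subset)
  show "CARD('n) \<le> vec.dim P + c + 1" using A T P K assms(5) by linarith
  assume "CARD('n) = vec.dim P + c + 1"
  then have "mat.dim {M \<in> ?A. M *v x = 0} \<le> mat.dim {M \<in> T. M *v x = 0}"
    using A T P K assms(5) by linarith
  moreover have "mat.subspace {M \<in> R. M *v x = 0}" if "mat.subspace R" for R :: "('a^'n^'n) set"
    using that by (intro mat.subspaceI)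
      (simp_all add: mat.subspace_0 mat.subspace_add mat.subspace_scale matrix_vector_mult_add_rdistrib mat_scale_mult)
  ultimately have "{M \<in> T. M *v x = 0} = {M \<in> ?A. M *v x = 0}"
    using mat.subspace_dim_equal sub assms(1) subspace_alternating by blast
  then show "{M \<in> ?A. M *v x = 0} \<subseteq> T" by blast
qed

section \<open>Additive maps acting as scalars modulo a subspace\<close>

lemma obtain_outside:
  assumes "vec.subspace Z" "vec.dim Z < vec.dim L"
  obtains q where "q \<in> L" "q \<notin> Z"
  using vec.dim_subset[of L Z] assms(2) by fastforce

lemma subspace_scale_cancel:
  assumes "vec.subspace Z" "c *s x \<in> Z" "c \<noteq> 0"
  shows "x \<in> Z"
  using vec.subspace_scale[OF assms(1,2), of "inverse c"] assms(3) by simp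

text \<open>\<open>R\<close> plays the part of a map that is only defined modulo \<open>Z\<close>.\<close>

lemma homothety_mod:
  fixes L Z :: "('a::field^'n) set"
  assumes Z: "vec.subspace Z" and dim: "vec.dim Z + 2 \<le> vec.dim L"
    and ex: "\<And>q. q \<in> L \<Longrightarrow> \<exists>f. R q f"
    and add: "\<And>q q' f f'. R q f \<Longrightarrow> R q' f' \<Longrightarrow> R (q + q') (f + f')"
    and scal: "\<And>q f. R q f \<Longrightarrow> \<exists>c. f - c *s q \<in> Z"
  shows "\<exists>l. \<forall>q\<in>L. \<forall>f. R q f \<longrightarrow> f - l *s q \<in> Z"
proof -
  \<comment> \<open>Vectors independent modulo \<open>Z\<close> have equal factors, because both
    must equal the factor \<open>e\<close> of \<open>q + q'\<close>.\<close>
  have key: "c = d" if "R q f" "R q' f'" "f - c *s q \<in> Z" "f' - d *s q' \<in> Z"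
    "q \<notin> Z" "q' \<notin> vec.span (insert q Z)" for q f q' f' c d
  proof -
    note h = that
    obtain e where "f + f' - e *s (q + q') \<in> Z" using scal[OF add[OF h(1,2)]] by blast
    with h(3,4) have "(f - c *s q) + (f' - d *s q') - (f + f' - e *s (q + q')) \<in> Z"
      using vec.subspace_add[OF Z] vec.subspace_diff[OF Z] by blast
    moreover have "(f - c *s q) + (f' - d *s q') - (f + f' - e *s (q + q')) = (e - c) *s q + (e - d) *s q'"
      by (simp add: vec_eq_iff algebra_simps)
    ultimately have *: "(e - c) *s q + (e - d) *s q' \<in> Z" by (simp only:)
    have "e = d"
    proof (rule ccontr)
      assume "e \<noteq> d"
      have "(e - d) *s q' = ((e - c) *s q + (e - d) *s q') - (e - c) *s q" by simp
      also have "\<dots> \<in> vec.span (insert q Z)"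
        using * by (intro vec.span_diff vec.span_scale vec.span_base) auto
      finally have "q' \<in> vec.span (insert q Z)"
        by (rule subspace_scale_cancel[OF vec.subspace_span]) (simp add: \<open>e \<noteq> d\<close>)
      then show False using h by blast
    qed
    with * have "(e - c) *s q \<in> Z" by simp
    then have "e = c" using subspace_scale_cancel[OF Z, of "e - c" q] \<open>q \<notin> Z\<close> by auto
    with \<open>e = d\<close> show ?thesis by simp
  qed
  have dim_insert: "vec.dim (vec.span (insert q Z)) < vec.dim L" for q
    using dim by (simp add: vec.dim_insert)
  \<comment> \<open>\<open>q1\<close> and \<open>q2\<close> are independent modulo \<open>Z\<close>,
    so any \<open>q\<close> outside \<open>Z\<close> is independent modulo \<open>Z\<close> of one
    of them and inherits the common factor. For \<open>q\<close> in \<open>Z\<close> every factor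
    works.\<close>
  obtain q1 where q1: "q1 \<in> L" "q1 \<notin> Z" using obtain_outside[OF Z, of L] dim by auto
  obtain q2 where q2: "q2 \<in> L" "q2 \<notin> vec.span (insert q1 Z)"
    using obtain_outside[OF vec.subspace_span dim_insert] by blast
  obtain f1 f2 where f: "R q1 f1" "R q2 f2" using ex q1 q2 by blast
  obtain l l2 where l: "f1 - l *s q1 \<in> Z" "f2 - l2 *s q2 \<in> Z" using scal f by blast
  have l2: "l2 = l" using key[OF f l q1(2) q2(2)] by simp
  have "q2 \<notin> Z" using q2 by (auto intro: vec.span_base)
  show ?thesis
  proof (intro exI[of _ l] ballI allI impI)
    fix q f' assume q: "q \<in> L" "R q f'"
    obtain d where d: "f' - d *s q \<in> Z" using scal q by blast
    show "f' - l *s q \<in> Z"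
    proof (cases "q \<in> Z")
      case True
      have "f' - l *s q = (f' - d *s q) + (d - l) *s q" by (simp add: vec.scale_left_diff_distrib)
      also have "\<dots> \<in> Z" using True d Z by (simp add: vec.subspace_add vec.subspace_scale)
      finally show ?thesis .
    next
      case False
      show ?thesis
      proof (cases "q \<in> vec.span (insert q1 Z)")
        case False
        then show ?thesis using key[OF f(1) q(2) l(1) d q1(2)] d by simp
      next
        case True
        have "q2 \<notin> vec.span (insert q Z)"
        proof
          assume "q2 \<in> vec.span (insert q Z)"
          moreover have "vec.span (insert q Z) \<subseteq> vec.span (insert q1 Z)"
            using True by (intro vec.span_minimal) (auto intro: vec.span_base)
          ultimately show False using q2 by blast
        qed
        then show ?thesis using key[OF q(2) f(2) d l(2) \<open>q \<notin> Z\<close>] d l2 by simp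
      qed
    qed
  qed
qed

section \<open>Restriction to a subspace\<close>

text \<open>Matrices are read as bilinear forms, and everything is restricted to a subspace \<open>H\<close>. Rather
  than passing to forms on \<open>H\<close>, one works modulo \<open>null_on H\<close>: the restriction of \<open>S\<close> to \<open>H\<close> has the
  same codimension as \<open>extend_null H S\<close>, and vectors restricted to functionals on \<open>H\<close> are vectors
  modulo \<open>ann H\<close>. \<open>B\<close> is the set of exceptional kernel vectors.\<close>

definition null_on :: "('a::field^'n) set \<Rightarrow> ('a^'n^'n) set"
  where "null_on H = {M \<in> alternating_mats. \<forall>x\<in>H. M *v x \<in> ann H}"

definition extend_null :: "('a::field^'n) set \<Rightarrow> ('a^'n^'n) set \<Rightarrow> ('a^'n^'n) set"
  where "extend_null H S = {M + N |M N. M \<in> S \<and> N \<in> null_on H}"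

text \<open>For alternating \<open>M\<close> the range is the annihilator of the kernel, so range
  compatibility can be tested on kernel vectors \<open>u\<close>. This dual form restricts to
  \<open>H\<close> and leaves room for exceptions.\<close>

definition range_compatible_off ::
    "('a::field^'n) set \<Rightarrow> ('a^'n) set \<Rightarrow> ('a^'n^'n) set \<Rightarrow> ('a^'n^'n \<Rightarrow> 'a^'n) \<Rightarrow> bool"
  where "range_compatible_off H B S F \<longleftrightarrow>
    (\<forall>M\<in>S. \<forall>u\<in>H - B. M *v u \<in> ann H \<longrightarrow> u \<cdot> F M = 0)"

lemma subspace_null_on [simp]: "mat.subspace (null_on H)"
  using subspace_alternating
  by (intro mat.subspaceI) (auto simp: null_on_def matrix_vector_mult_add_rdistrib mat_scale_mult
      mat.subspace_0 mat.subspace_add mat.subspace_scale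
      intro: vec.subspace_0[OF subspace_ann] vec.subspace_add[OF subspace_ann] vec.subspace_scale[OF subspace_ann])

lemma subspace_extend_null [simp]: "mat.subspace S \<Longrightarrow> mat.subspace (extend_null H S)"
  unfolding extend_null_def by (rule mat.subspace_sums) simp_all

lemma extend_null_alternating: "S \<subseteq> alternating_mats \<Longrightarrow> extend_null H S \<subseteq> alternating_mats"
  using mat.subspace_add[OF subspace_alternating] by (fastforce simp: extend_null_def null_on_def)

lemma null_subset_extend_null: "mat.subspace S \<Longrightarrow> null_on H \<subseteq> extend_null H S"
  unfolding extend_null_def using mat.subspace_0[of S] by (metis (mono_tags, lifting) add_0 mem_Collect_eq subsetI)

lemma null_mult: "N \<in> null_on H \<Longrightarrow> x \<in> H \<Longrightarrow> N *v x \<in> ann H"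
  by (simp add: null_on_def)

text \<open>By double annihilation: restricting functionals from \<open>H\<close> to the hyperplane
  of \<open>p\<close> means working modulo \<open>p\<close> as well.\<close>

lemma ann_Int_hyperplane:
  assumes "vec.subspace H"
  shows "ann (H \<inter> ann {p}) = vec.span (insert p (ann H))"
proof -
  have "H \<inter> ann {p} = ann (ann H) \<inter> ann {p}" by (simp add: ann_ann assms)
  also have "\<dots> = ann (insert p (ann H))" by (auto simp: ann_def)
  also have "\<dots> = ann (vec.span (insert p (ann H)))" by (simp add: ann_span)
  finally show ?thesis by (simp add: ann_ann)
qed

section \<open>Rank-two forms with a fixed factor\<close>

lemma wedge_null_on:
  assumes "q \<in> ann H"
  shows "wedge p q \<in> null_on H"
  using assms by (auto simp: null_on_def wedge_mult ann_def dot_commute)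

lemma wedge_null_on_hyperplane: "wedge p q \<in> null_on (H \<inter> ann {p})"
  by (auto simp: null_on_def wedge_mult ann_def dot_commute)

text \<open>On passing from \<open>H\<close> to the hyperplane of \<open>p\<close>, the bound on the
  codimension of \<open>S\<close> drops by the codimension of this space, and its annihilator joins
  the exceptional set.\<close>

definition wedge_partners :: "('a::field^'n) set \<Rightarrow> ('a^'n^'n) set \<Rightarrow> 'a^'n \<Rightarrow> ('a^'n) set"
  where "wedge_partners H S p = {q. wedge p q \<in> extend_null H S}"

lemma subspace_wedge_partners [simp]:
  assumes "mat.subspace S"
  shows "vec.subspace (wedge_partners H S p)"
proof -
  have "wedge p 0 = 0" by (simp add: wedge_def vec_eq_iff)
  then show ?thesis
    using subspace_extend_null[OF assms, of H]
    by (intro vec.subspaceI) (simp_all add: wedge_partners_def wedge_linear_simps mat.subspace_0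
        mat.subspace_add mat.subspace_scale)
qed

lemma span_subset_wedge_partners:
  assumes "mat.subspace S"
  shows "vec.span (insert p (ann H)) \<subseteq> wedge_partners H S p"
proof (intro vec.span_minimal subspace_wedge_partners assms insert_subsetI subsetI)
  have "wedge p p = 0" by (simp add: wedge_def vec_eq_iff)
  then show "p \<in> wedge_partners H S p"
    using mat.subspace_0[OF subspace_extend_null[OF assms]] by (simp add: wedge_partners_def)
  fix q assume "q \<in> ann H"
  then show "q \<in> wedge_partners H S p"
    using wedge_null_on[of q H p] null_subset_extend_null[OF assms, of H] unfolding wedge_partners_def by blast
qed

text \<open>Both claims measure \<open>Q\<close>, the sum of \<open>extend_null H S\<close> and all
  \<open>wedge p q\<close>, whose dimension exceeds that of \<open>extend_null H S\<close> by
  \<open>CARD('n) - vec.dim L\<close>. It consists of alternating matrices, which gives the first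
  claim; every \<open>wedge p q\<close> is null on the hyperplane of \<open>p\<close>, which gives
  the second.\<close>

lemma codim_hyperplane:
  fixes S :: "('a::field^'n^'n) set"
  assumes S: "mat.subspace S" "S \<subseteq> alternating_mats" and "p \<noteq> 0"
    and c: "mat.dim (alternating_mats :: ('a^'n^'n) set) \<le> mat.dim (extend_null H S) + c"
  defines "L \<equiv> wedge_partners H S p"
  shows "CARD('n) \<le> vec.dim L + c"
    and "mat.dim (alternating_mats :: ('a^'n^'n) set)
      \<le> mat.dim (extend_null (H \<inter> ann {p}) S) + (c - (CARD('n) - vec.dim L))"
proof -
  let ?T = "extend_null H S" and ?W = "range (wedge p)" and ?A = "alternating_mats :: ('a^'n^'n) set"
  have lin: "Vector_Spaces.linear (*s) mat_scale (wedge p)"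
    by (simp add: Vector_Spaces.linear_iff wedge_linear_simps vec.vector_space_axioms mat.vector_space_axioms)
  interpret w: Vector_Spaces.linear "(*s)" mat_scale "wedge p" by (rule lin)
  have W: "mat.subspace ?W" by (rule w.subspace_image) simp
  have "?T \<inter> ?W = wedge p ` L" by (auto simp: L_def wedge_partners_def)
  moreover have "p \<in> L" using span_subset_wedge_partners[OF S(1), of p H] vec.span_base[of p "insert p (ann H)"] by (auto simp: L_def)
  ultimately have L: "vec.dim L = mat.dim (?T \<inter> ?W) + 1"
    using dim_wedge_image[of L p] S assms(3) by (simp add: L_def)
  have N: "CARD('n) = mat.dim ?W + 1"
    using dim_wedge_image[of UNIV p] assms(3) by (simp add: card_cart_basis)
  define Q where "Q = {x + y |x y. x \<in> ?T \<and> y \<in> ?W}"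
  have Q: "mat.dim Q + mat.dim (?T \<inter> ?W) = mat.dim ?T + mat.dim ?W"
    unfolding Q_def by (rule mat.dim_sums_Int[OF subspace_extend_null[OF S(1)] W])
  have "Q \<subseteq> ?A"
    using extend_null_alternating[OF S(2), of H] mat.subspace_add[OF subspace_alternating]
    by (fastforce simp: Q_def)
  then have QA: "mat.dim Q \<le> mat.dim ?A" by (rule mat.dim_subset)
  show n: "CARD('n) \<le> vec.dim L + c" using L N Q QA c by linarith
  have "Q \<subseteq> extend_null (H \<inter> ann {p}) S"
  proof
    fix M assume "M \<in> Q"
    then obtain M0 N q where M: "M = (M0 + N) + wedge p q" "M0 \<in> S" "N \<in> null_on H"
      by (auto simp: Q_def extend_null_def)
    have "N \<in> null_on (H \<inter> ann {p})"
      using M(3) by (auto simp: null_on_def ann_def)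
    then have "N + wedge p q \<in> null_on (H \<inter> ann {p})"
      using mat.subspace_add[OF subspace_null_on] wedge_null_on_hyperplane by blast
    with M show "M \<in> extend_null (H \<inter> ann {p}) S"
      unfolding extend_null_def by (auto simp: add.assoc)
  qed
  then have "mat.dim Q \<le> mat.dim (extend_null (H \<inter> ann {p}) S)" by (rule mat.dim_subset)
  then show "mat.dim ?A \<le> mat.dim (extend_null (H \<inter> ann {p}) S) + (c - (CARD('n) - vec.dim L))"
    using L N Q c n mat.dim_subset[of "?T \<inter> ?W" ?W] by simp
qed

lemma dim_insert_ann:
  fixes H :: "('a::field^'n) set"
  shows "vec.dim (vec.span (insert p (ann H))) \<le> CARD('n) - vec.dim H + 1"
proof -
  have "vec.dim (vec.span (insert p (ann H))) \<le> vec.dim (ann H) + 1"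
    by (simp add: vec.dim_insert)
  then show ?thesis using dim_ann[of H] by linarith
qed

text \<open>Modulo \<open>ann H\<close> and \<open>p\<close>, the map \<open>F\<close> sends \<open>wedge p q\<close> to a multiple of \<open>q\<close>, and the space
  of admissible \<open>q\<close> is large enough for the factor not to depend on \<open>q\<close>.\<close>

lemma wedge_eigenvalue:
  fixes S :: "('a::field^'n^'n) set"
  assumes S: "mat.subspace S" "S \<subseteq> alternating_mats" and F: "additive_on S F"
    and H: "vec.subspace H" and B: "vec.subspace B"
    and rc: "range_compatible_off H B S F"
    and c: "mat.dim (alternating_mats :: ('a^'n^'n) set) \<le> mat.dim (extend_null H S) + c"
    and bounds: "c + 3 \<le> vec.dim H" "vec.dim B + c + 2 \<le> vec.dim H"
    and p: "p \<noteq> 0" "B \<subseteq> {0} \<or> (\<exists>b\<in>B. p \<cdot> b \<noteq> 0)"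
  obtains l where "\<And>M q. M \<in> S \<Longrightarrow> M - wedge p q \<in> null_on H \<Longrightarrow> F M - l *s q \<in> ann (H \<inter> ann {p})"
proof -
  let ?Z = "ann (H \<inter> ann {p})" and ?L = "wedge_partners H S p"
  define R where "R q f \<longleftrightarrow> (\<exists>M\<in>S. M - wedge p q \<in> null_on H \<and> f = F M)" for q f
  have dimH: "vec.dim H \<le> CARD('n)" using dim_ann[of H] by linarith
  have "vec.dim ?Z \<le> CARD('n) - vec.dim H + 1"
    unfolding ann_Int_hyperplane[OF H] by (rule dim_insert_ann)
  \<comment> \<open>Here \<open>c + 3 \<le> vec.dim H\<close> enters: \<open>?L\<close> has
    codimension at most \<open>c\<close>.\<close>
  then have dim: "vec.dim ?Z + 2 \<le> vec.dim ?L"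
    using codim_hyperplane(1)[OF S p(1) c] bounds dimH by linarith
  have "\<exists>l. \<forall>q\<in>?L. \<forall>f. R q f \<longrightarrow> f - l *s q \<in> ?Z"
  proof (rule homothety_mod[of ?Z ?L R, OF subspace_ann dim])
    show "\<exists>f. R q f" if q: "q \<in> ?L" for q
    proof -
      obtain M N where "wedge p q = M + N" "M \<in> S" "N \<in> null_on H"
        using q by (auto simp: wedge_partners_def extend_null_def)
      then have "M \<in> S" "M - wedge p q \<in> null_on H"
        using mat.subspace_neg[OF subspace_null_on] by auto
      then show ?thesis by (auto simp: R_def)
    qed
    show "R (q + q') (f + f')" if R: "R q f" "R q' f'" for q q' f f'
    proof -
      obtain M M' where M: "M \<in> S" "M - wedge p q \<in> null_on H" "f = F M"
        "M' \<in> S" "M' - wedge p q' \<in> null_on H" "f' = F M'"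
        using R by (auto simp: R_def)
      have "(M - wedge p q) + (M' - wedge p q') \<in> null_on H"
        using M mat.subspace_add[OF subspace_null_on] by blast
      moreover have "(M - wedge p q) + (M' - wedge p q') = (M + M') - wedge p (q + q')"
        by (simp add: wedge_linear_simps)
      moreover have "f + f' = F (M + M')" using F M by (simp add: additive_on_def)
      moreover have "M + M' \<in> S" using M S by (simp add: mat.subspace_add)
      ultimately show ?thesis unfolding R_def by auto
    qed
    show "\<exists>d. f - d *s q \<in> ?Z" if R: "R q f" for q f
    proof -
      obtain M where M: "M \<in> S" "M - wedge p q \<in> null_on H" "f = F M"
        using R by (auto simp: R_def)
      \<comment> \<open>\<open>wedge p q\<close> kills \<open>?K\<close>, so range compatibility
        should force \<open>f\<close> into \<open>ann ?K\<close>, which is spanned by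
        \<open>q\<close> and \<open>?Z\<close>. This requires that \<open>?K\<close> not lie inside
        \<open>B\<close>.\<close>
      let ?K = "(H \<inter> ann {p}) \<inter> ann {q}"
      have subH: "vec.subspace (H \<inter> ann {p})" using H by (simp add: vec.subspace_inter)
      have K: "ann ?K = vec.span (insert q ?Z)" by (rule ann_Int_hyperplane[OF subH])
      have "vec.dim (ann ?K) \<le> vec.dim ?Z + 1" unfolding K by (simp add: vec.dim_insert)
      then have dimK: "vec.dim H \<le> vec.dim ?K + 2"
        using dim_ann[of ?K] dim_ann[of H] \<open>vec.dim ?Z \<le> _\<close> dimH by linarith
      have subK: "vec.subspace ?K" using subH by (simp add: vec.subspace_inter)
      \<comment> \<open>The dimension of \<open>?K\<close> is at least that of \<open>B\<close> and
        positive, so containment would give a nonzero \<open>B = ?K\<close> on which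
        \<open>p\<close> vanishes, against the choice of \<open>p\<close>.\<close>
      have "\<not> ?K \<subseteq> B"
      proof
        assume KB: "?K \<subseteq> B"
        then have "?K = B"
          using dimK bounds by (intro vec.subspace_dim_equal[OF subK B]) auto
        moreover have "\<not> B \<subseteq> {0}"
        proof
          assume "B \<subseteq> {0}"
          then have "vec.dim B = 0" by (simp add: vec.dim_eq_0)
          then show False using dimK bounds unfolding \<open>?K = B\<close> by linarith
        qed
        ultimately show False using p(2) by (auto simp: ann_def)
      qed
      then have "f \<in> ann ?K"
      proof (rule span_avoiding_subspace[OF subK _ B])
        fix u assume u: "u \<in> ?K" "u \<notin> B"
        have "(M - wedge p q) *v u \<in> ann H" using M u null_mult by blast
        moreover have "wedge p q *v u = 0" using u by (simp add: wedge_mult ann_def dot_commute)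
        ultimately have "M *v u \<in> ann H" by (simp add: matrix_vector_mult_diff_rdistrib)
        then show "u \<cdot> f = 0" using rc u M unfolding range_compatible_off_def by blast
      qed
      then obtain d where "f - d *s q \<in> vec.span ?Z" unfolding K vec.span_breakdown_eq by blast
      then have "f - d *s q \<in> ?Z" by (simp add: vec.span_eq_iff[THEN iffD2])
      then show ?thesis ..
    qed
  qed
  then obtain l where l: "\<And>q f. q \<in> ?L \<Longrightarrow> R q f \<Longrightarrow> f - l *s q \<in> ?Z"
    by blast
  show thesis
  proof (rule that[of l])
    fix M q assume M: "M \<in> S" "M - wedge p q \<in> null_on H"
    then have "wedge p q - M \<in> null_on H"
      using mat.subspace_neg[OF subspace_null_on, of "M - wedge p q"] by simp
    then have "M + (wedge p q - M) \<in> extend_null H S" unfolding extend_null_def using M(1) by blast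
    then have "q \<in> ?L" by (simp add: wedge_partners_def)
    then show "F M - l *s q \<in> ?Z" using l M by (auto simp: R_def)
  qed
qed

section \<open>Induction over hyperplanes\<close>

text \<open>Over any field, a vector space is not the union of two proper subspaces;
  \<open>p + q\<close> is the usual witness.\<close>

lemma nonvanishing_at_two:
  fixes b w :: "'a::field^'n"
  assumes "b \<noteq> 0" "w \<noteq> 0"
  obtains p where "p \<cdot> b \<noteq> 0" "p \<cdot> w \<noteq> 0"
proof -
  obtain p where p: "p \<cdot> b = 1" using separate_from_subspace[of "{0}" b] assms by auto
  obtain q where q: "q \<cdot> w = 1" using separate_from_subspace[of "{0}" w] assms by auto
  consider "p \<cdot> w \<noteq> 0" | "q \<cdot> b \<noteq> 0" | "p \<cdot> w = 0" "q \<cdot> b = 0" by blast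
  then show thesis
  proof cases
    case 3
    then show thesis using that[of "p + q"] p q by simp
  qed (use that[of p] that[of q] p q in auto)
qed

text \<open>One functional nonzero at \<open>b\<close> and \<open>w\<close> is shifted by
  \<open>a\<close> and \<open>a'\<close>, which vanish at both and are independent modulo
  \<open>ann H\<close>. Evaluating a linear relation at \<open>b\<close> shows that its coefficients
  sum to zero, which leaves a relation between \<open>a\<close> and \<open>a'\<close>.\<close>

lemma three_functionals:
  fixes H :: "('a::field^'n) set"
  assumes bw: "b \<noteq> 0" "w \<noteq> 0" "b \<in> H" "w \<in> H" and dim: "vec.dim {b, w} + 2 \<le> vec.dim H"
  obtains p1 p2 p3 where "\<And>p. p \<in> {p1, p2, p3} \<Longrightarrow> p \<cdot> b \<noteq> 0 \<and> p \<cdot> w \<noteq> 0"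
    and "\<And>c1 c2 c3. c1 *s p1 + c2 *s p2 + c3 *s p3 \<in> ann H \<Longrightarrow> c1 = 0 \<and> c2 = 0 \<and> c3 = 0"
proof -
  obtain p where p: "p \<cdot> b \<noteq> 0" "p \<cdot> w \<noteq> 0" by (rule nonvanishing_at_two[OF bw(1,2)])
  have d: "vec.dim (ann H) + 2 \<le> vec.dim (ann {b, w})"
    using dim_ann[of H] dim_ann[of "{b, w}"] dim by linarith
  obtain a where a: "a \<in> ann {b, w}" "a \<notin> ann H"
    using obtain_outside[OF subspace_ann, of H "ann {b, w}"] d by auto
  have "vec.dim (vec.span (insert a (ann H))) < vec.dim (ann {b, w})"
    using d by (simp add: vec.dim_insert)
  then obtain a' where a': "a' \<in> ann {b, w}" "a' \<notin> vec.span (insert a (ann H))"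
    using obtain_outside[OF vec.subspace_span] by blast
  have "c1 = 0 \<and> c2 = 0 \<and> c3 = 0" if c: "c1 *s p + c2 *s (p + a) + c3 *s (p + a') \<in> ann H" for c1 c2 c3
  proof -
    have "b \<cdot> (c1 *s p + c2 *s (p + a) + c3 *s (p + a')) = 0" using c bw(3) by (rule annD)
    then have "(c1 + c2 + c3) * (p \<cdot> b) = 0"
      using a a' by (simp add: ann_def dot_commute algebra_simps)
    then have s: "c1 = - c2 - c3" using p by (simp add: eq_diff_eq minus_unique add.assoc add_eq_0_iff2)
    have "c1 *s p + c2 *s (p + a) + c3 *s (p + a') = c2 *s a + c3 *s a'"
      unfolding s by (simp add: vec_eq_iff algebra_simps)
    with c have e: "c2 *s a + c3 *s a' \<in> ann H" by simp
    have "c3 = 0"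
    proof (rule ccontr)
      assume "c3 \<noteq> 0"
      have "c3 *s a' = (c2 *s a + c3 *s a') - c2 *s a" by simp
      also have "\<dots> \<in> vec.span (insert a (ann H))"
        using e by (intro vec.span_diff vec.span_scale vec.span_base) auto
      finally have "a' \<in> vec.span (insert a (ann H))"
        using \<open>c3 \<noteq> 0\<close> by (rule subspace_scale_cancel[OF vec.subspace_span])
      then show False using a' by blast
    qed
    moreover from this e have "c2 = 0"
      using a subspace_scale_cancel[OF subspace_ann, of c2 a H] by auto
    ultimately show ?thesis using s by simp
  qed
  moreover have "x \<cdot> b \<noteq> 0 \<and> x \<cdot> w \<noteq> 0" if "x \<in> {p, p + a, p + a'}" for x
    using that p a a' by (auto simp: ann_def dot_commute)
  ultimately show thesis using that[of p "p + a" "p + a'"] by blast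
qed

section \<open>Descent to a hyperplane\<close>

lemma additive_on_subtract_local:
  assumes "additive_on S F"
  shows "additive_on S (\<lambda>M. F M - M *v x)"
  using assms by (simp add: additive_on_def matrix_vector_mult_add_rdistrib)

lemma range_compatible_off_subtract_local:
  assumes "range_compatible_off H B S F" "S \<subseteq> alternating_mats" "x \<in> H"
  shows "range_compatible_off H B S (\<lambda>M. F M - M *v x)"
proof -
  have "u \<cdot> (M *v x) = 0" if "M \<in> S" "M *v u \<in> ann H" for M u
    using alternating_skew[of M u x] assms(2,3) that by (auto simp: ann_def)
  then show ?thesis using assms(1) by (simp add: range_compatible_off_def)
qed

text \<open>If \<open>M *v u\<close> is \<open>t *s p\<close> modulo \<open>ann H\<close>, add some
  \<open>N\<close> in \<open>S\<close> that agrees on \<open>H\<close> with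
  \<open>wedge p q\<close>, where \<open>q \<cdot> u = - t\<close>. Then \<open>u\<close> becomes a
  kernel vector of \<open>M + N\<close> on \<open>H\<close>, and \<open>F N\<close> contributes
  nothing at \<open>u\<close>. Such a \<open>q\<close> exists unless \<open>u\<close> annihilates
  all wedge partners.\<close>

lemma range_compatible_off_hyperplane:
  fixes S :: "('a::field^'n^'n) set"
  assumes S: "mat.subspace S" "S \<subseteq> alternating_mats" and F: "additive_on S F"
    and H: "vec.subspace H" and B: "vec.subspace B"
    and rc: "range_compatible_off H B S F"
    and wedges: "\<And>M q. M \<in> S \<Longrightarrow> M - wedge p q \<in> null_on H \<Longrightarrow> F M \<in> ann (H \<inter> ann {p})"
  shows "range_compatible_off (H \<inter> ann {p})
    {x + y |x y. x \<in> ann (wedge_partners H S p) \<and> y \<in> B \<inter> ann {p}} S F"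
  unfolding range_compatible_off_def
proof (intro ballI impI)
  let ?L = "wedge_partners H S p"
  fix M u assume M: "M \<in> S" and u: "u \<in> (H \<inter> ann {p}) - {x + y |x y. x \<in> ann ?L \<and> y \<in> B \<inter> ann {p}}"
    and Mu: "M *v u \<in> ann (H \<inter> ann {p})"
  have "u \<notin> ann ?L"
  proof
    assume "u \<in> ann ?L"
    moreover have "u = u + 0" "0 \<in> B \<inter> ann {p}"
      using vec.subspace_0[OF B] vec.subspace_0[OF subspace_ann] by auto
    ultimately show False using u by blast
  qed
  have "u \<notin> B"
  proof
    assume "u \<in> B"
    moreover have "u = 0 + u" "0 \<in> ann ?L"
      using vec.subspace_0[OF subspace_ann] by auto
    ultimately show False using u by blast
  qed
  obtain t where "M *v u - t *s p \<in> vec.span (ann H)"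
    using Mu unfolding ann_Int_hyperplane[OF H] vec.span_breakdown_eq by blast
  then have t: "M *v u - t *s p \<in> ann H" by (simp add: vec.span_eq_iff[THEN iffD2])
  obtain q0 where q0: "q0 \<in> ?L" "q0 \<cdot> u \<noteq> 0"
    using \<open>u \<notin> ann ?L\<close> by (auto simp: ann_def)
  define q where "q = (- t / (q0 \<cdot> u)) *s q0"
  have q: "q \<in> ?L" "q \<cdot> u = - t"
    unfolding q_def using q0 by (simp_all only: vec.subspace_scale[OF subspace_wedge_partners[OF S(1)]]) simp
  obtain N E where N: "wedge p q = N + E" "N \<in> S" "E \<in> null_on H"
    using q(1) by (auto simp: wedge_partners_def extend_null_def)
  have "N - wedge p q \<in> null_on H"
    using mat.subspace_neg[OF subspace_null_on N(3)] N(1) by simp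
  then have FN: "u \<cdot> F N = 0" using wedges[OF N(2)] u by (auto intro: annD)
  have "N *v u = wedge p q *v u - E *v u" using N(1) by (simp add: matrix_vector_mult_add_rdistrib)
  also have "wedge p q *v u = - t *s p"
    using u q(2) by (simp add: wedge_mult ann_def dot_commute)
  finally have "(M + N) *v u = (M *v u - t *s p) - E *v u"
    by (simp add: matrix_vector_mult_add_rdistrib)
  also have "\<dots> \<in> ann H"
    by (rule vec.subspace_diff[OF subspace_ann t null_mult[OF N(3)]]) (use u in blast)
  finally have "u \<cdot> F (M + N) = 0"
    using rc u \<open>u \<notin> B\<close> mat.subspace_add[OF S(1) M N(2)] unfolding range_compatible_off_def by blast
  then show "u \<cdot> F M = 0" using F M N(2) FN by (simp add: additive_on_def)
qed

text \<open>Two different local models, exact modulo \<open>p1, p2\<close> and modulo \<open>p1, p3\<close>, would exhaust the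
  codimension of \<open>T\<close> twice.\<close>

lemma local_models_agree:
  fixes T :: "('a::field^'n^'n) set"
  assumes T: "mat.subspace T" "T \<subseteq> alternating_mats"
    and c: "mat.dim (alternating_mats :: ('a^'n^'n) set) \<le> mat.dim T + c"
    and dims: "c + 3 \<le> h" "4 \<le> h" "h \<le> CARD('n)"
    and P: "vec.subspace P2" "vec.subspace P3"
      "vec.dim P2 \<le> CARD('n) - h + 2" "vec.dim P3 \<le> CARD('n) - h + 2"
      "vec.dim (P2 \<inter> P3) \<le> CARD('n) - h + 1"
    and ev: "\<And>M. M \<in> T \<Longrightarrow> M *v x \<in> P2" "\<And>M. M \<in> T \<Longrightarrow> M *v y \<in> P3"
  shows "x = 0 \<or> y = 0"
proof (rule ccontr)
  assume "\<not> (x = 0 \<or> y = 0)"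
  then have xy: "x \<noteq> 0" "y \<noteq> 0" by auto
  show False
  proof (cases "y \<in> vec.span {x}")
    case True
    then obtain k where k: "y = k *s x" by (auto simp: vec.span_singleton)
    with xy have "k \<noteq> 0" by auto
    \<comment> \<open>Proportional \<open>x\<close> and \<open>y\<close> make evaluation at
      \<open>x\<close> land in \<open>P2 \<inter> P3\<close>, whose dimension is below the bound of
      \<open>codim_eval\<close>.\<close>
    have "M *v x \<in> P2 \<inter> P3" if "M \<in> T" for M
    proof -
      have "k *s (M *v x) \<in> P3" using ev(2)[OF that] by (simp add: k vector_scalar_commute)
      then show ?thesis using ev(1)[OF that] subspace_scale_cancel[OF P(2) _ \<open>k \<noteq> 0\<close>] by blast
    qed
    then show False using codim_eval(1)[OF T xy(1) _ c, of "P2 \<inter> P3"] P dims by fastforce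
  next
    case False
    then have False': "x \<notin> vec.span {y}"
      using xy by (auto simp: vec.span_singleton) (metis False vec.scale_left_imp_eq vec.scale_zero_left
        vec.span_singleton rangeI subspace_scale_cancel vec.subspace_span vec.span_base singletonI)
    \<comment> \<open>The dimension of \<open>P\<close> forces equality in
      \<open>codim_eval\<close>, so \<open>T\<close> contains every alternating matrix that kills
      \<open>x\<close>. Among these is \<open>wedge a u\<close>, which sends \<open>y\<close> to
      \<open>a\<close>.\<close>
    have wedges: "ann {x, y} \<subseteq> Q"
      if h: "x \<noteq> 0" "y \<notin> vec.span {x}" "\<And>M. M \<in> T \<Longrightarrow> M *v x \<in> P" "\<And>M. M \<in> T \<Longrightarrow> M *v y \<in> Q"
        "vec.dim P \<le> CARD('n) - h + 2" for x y P Q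
    proof
      fix a assume a: "a \<in> ann {x, y}"
      obtain u where u: "u \<in> ann (vec.span {x})" "u \<cdot> y = 1"
        using separate_from_subspace[OF vec.subspace_span h(2)] by blast
      have "CARD('n) \<le> vec.dim P + c + 1" by (rule codim_eval(1)[OF T h(1,3) c])
      then have eq: "CARD('n) = vec.dim P + c + 1" using h(5) dims by linarith
      have "{M \<in> alternating_mats. M *v x = 0} \<subseteq> T"
        by (rule codim_eval(2)[OF T h(1,3) c eq])
      moreover have "wedge a u *v x = 0"
        using a annD[OF u(1) vec.span_base[of x "{x}"]] by (simp add: wedge_mult ann_def dot_commute)
      ultimately have "wedge a u \<in> T" by auto
      moreover have "wedge a u *v y = a" using a u by (simp add: wedge_mult ann_def dot_commute)
      ultimately show "a \<in> Q" using h(4) by metis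
    qed
    have "ann {x, y} \<subseteq> P3" by (rule wedges[OF xy(1) False ev P(3)])
    moreover have "ann {x, y} \<subseteq> P2"
      using wedges[OF xy(2) False' ev(2,1) P(4)] by (simp add: insert_commute)
    \<comment> \<open>The left side is at least \<open>CARD('n) - 2\<close>, the right side at most
      \<open>CARD('n) - 3\<close> because \<open>4 \<le> h\<close>.\<close>
    ultimately have "vec.dim (ann {x, y}) \<le> vec.dim (P2 \<inter> P3)"
      by (intro vec.dim_subset) auto
    moreover have "vec.dim {x, y} \<le> 2"
      using vec.dim_le_card'[of "{x, y}"] card_insert_le_m1[of 2 "{y}" x] by simp
    ultimately show False using dim_ann[of "{x, y}"] P(5) dims by linarith
  qed
qed

text \<open>After subtracting a local map, \<open>F\<close> vanishes modulo \<open>p\<close> on the \<open>wedge p q\<close>, so it descends to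
  the hyperplane of \<open>p\<close>. The exceptional set grows by \<open>ann L\<close> exactly as fast as the codimension
  drops, and the choice of \<open>p\<close> cuts it down by one if it is nonzero.\<close>

lemma local_mod_functional:
  fixes S :: "('a::field^'n^'n) set"
  assumes S: "mat.subspace S" "S \<subseteq> alternating_mats" and F: "additive_on S F"
    and H: "vec.subspace H" and B: "vec.subspace B" "B \<subseteq> H"
    and rc: "range_compatible_off H B S F"
    and c: "mat.dim (alternating_mats :: ('a^'n^'n) set) \<le> mat.dim (extend_null H S) + c"
    and bounds: "c + 3 \<le> vec.dim H" "vec.dim B + c + 2 \<le> vec.dim H" "4 \<le> vec.dim H"
    and p: "b \<in> H" "p \<cdot> b \<noteq> 0" "B \<subseteq> {0} \<or> b \<in> B" "c = 0 \<or> wedge_partners H S p \<noteq> UNIV"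
    and IH: "\<And>F B' c'. \<lbrakk>additive_on S F; vec.subspace B'; B' \<subseteq> H \<inter> ann {p};
      range_compatible_off (H \<inter> ann {p}) B' S F;
      mat.dim (alternating_mats :: ('a^'n^'n) set) \<le> mat.dim (extend_null (H \<inter> ann {p}) S) + c';
      c' + 3 \<le> vec.dim (H \<inter> ann {p}); vec.dim B' + c' + 2 \<le> vec.dim (H \<inter> ann {p})\<rbrakk>
      \<Longrightarrow> \<exists>x\<in>H \<inter> ann {p}. \<forall>M\<in>S. F M - M *v x \<in> ann (H \<inter> ann {p})"
  shows "\<exists>x\<in>H. \<forall>M\<in>S. F M - M *v x \<in> ann (H \<inter> ann {p})"
proof -
  let ?H = "H \<inter> ann {p}" and ?L = "wedge_partners H S p"
  have p0: "p \<noteq> 0" using p(2) by auto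
  obtain l where l: "\<And>M q. M \<in> S \<Longrightarrow> M - wedge p q \<in> null_on H \<Longrightarrow> F M - l *s q \<in> ann ?H"
    using wedge_eigenvalue[OF S F H B(1) rc c bounds(1,2) p0] p(2,3) by blast
  \<comment> \<open>Scaled so that \<open>p \<cdot> x = - l\<close>: modulo \<open>p\<close>,
    \<open>wedge p q *v x\<close> is then \<open>l *s q\<close>, which cancels the factor.\<close>
  define x where "x = (- l / (p \<cdot> b)) *s b"
  have x: "x \<in> H" "p \<cdot> x = - l"
    using p(1,2) unfolding x_def by (simp_all only: vec.subspace_scale[OF H]) simp
  define F' where "F' = (\<lambda>M. F M - M *v x)"
  have F': "additive_on S F'" unfolding F'_def by (rule additive_on_subtract_local[OF F])
  have wedges: "F' M \<in> ann ?H" if M: "M \<in> S" "M - wedge p q \<in> null_on H" for M q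
  proof -
    have "(M - wedge p q) *v x \<in> ann H" by (rule null_mult[OF M(2) x(1)])
    then have 1: "(M - wedge p q) *v x \<in> ann ?H" by (auto simp: ann_def)
    have 2: "(q \<cdot> x) *s p \<in> ann ?H" by (auto simp: ann_def dot_commute)
    have "F' M = (F M - l *s q) - ((M - wedge p q) *v x) - (q \<cdot> x) *s p"
      by (simp add: F'_def matrix_vector_mult_diff_rdistrib wedge_mult x(2))
    also have "\<dots> \<in> ann ?H"
      by (intro vec.subspace_diff[OF subspace_ann] l[OF M] 1 2)
    finally show ?thesis .
  qed
  define B' where "B' = {x + y |x y. x \<in> ann ?L \<and> y \<in> B \<inter> ann {p}}"
  have rc': "range_compatible_off ?H B' S F'"
    unfolding B'_def
    by (rule range_compatible_off_hyperplane[OF S F' H B(1) _ wedges])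
      (auto simp: F'_def intro: range_compatible_off_subtract_local[OF rc S(2) x(1)])
  have Bp: "vec.subspace (B \<inter> ann {p})" using B(1) by (simp add: vec.subspace_inter)
  have subB': "vec.subspace B'" unfolding B'_def by (rule vec.subspace_sums[OF subspace_ann Bp])
  have subH: "vec.subspace ?H" using H by (simp add: vec.subspace_inter)
  have "ann ?L \<subseteq> ann (vec.span (insert p (ann H)))"
    using span_subset_wedge_partners[OF S(1), of p H] by (auto simp: ann_def)
  also have "\<dots> = ?H"
    unfolding ann_Int_hyperplane[OF H, symmetric] by (rule ann_ann[OF subH])
  finally have "ann ?L \<subseteq> ?H" .
  then have B'H: "B' \<subseteq> ?H"
    using B(2) vec.subspace_add[OF subH] unfolding B'_def by blast
  define d where "d = vec.dim (ann ?L)"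
  have L: "d + vec.dim ?L = CARD('n)" unfolding d_def by (rule dim_ann)
  have codim: "CARD('n) \<le> vec.dim ?L + c"
    "mat.dim (alternating_mats :: ('a^'n^'n) set) \<le> mat.dim (extend_null ?H S) + (c - (CARD('n) - vec.dim ?L))"
    using codim_hyperplane[OF S p0 c] by auto
  have dimH: "vec.dim H = vec.dim ?H + 1" by (rule dim_hyperplane_section[OF H p(1,2)])
  have dimB': "vec.dim B' \<le> d + vec.dim (B \<inter> ann {p})"
    using vec.dim_sums_Int[OF subspace_ann Bp, of ?L] unfolding B'_def d_def by simp
  have dimB: "vec.dim (B \<inter> ann {p}) = 0 \<or> vec.dim B = vec.dim (B \<inter> ann {p}) + 1"
    using p(3) dim_hyperplane_section[OF B(1) _ p(2)] by (auto simp: vec.dim_eq_0)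
  have cd: "c = 0 \<or> 0 < d"
  proof -
    have "vec.dim ?L \<noteq> CARD('n)" if "?L \<noteq> UNIV"
    proof
      assume "vec.dim ?L = CARD('n)"
      then have "vec.span ?L = UNIV"
        using vec.dim_eq_full[of ?L] by (simp add: card_cart_basis vec.dimension_def)
      then show False using that subspace_wedge_partners[OF S(1), of H p]
        by (simp add: vec.span_eq_iff[THEN iffD2])
    qed
    then show ?thesis using p(4) L by (cases "?L = UNIV") auto
  qed
  have "CARD('n) - vec.dim ?L = d" using L by simp
  moreover obtain e where e: "c = d + e" using codim(1) L le_Suc_ex[of d c] by auto
  ultimately have e': "c - (CARD('n) - vec.dim ?L) = e" by simp
  \<comment> \<open>The dimension of \<open>H\<close> falls by one. In the first bound this is
    offset by \<open>0 < d\<close>, or by \<open>4 \<le> vec.dim H\<close> if \<open>c = 0\<close>.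
    In the second, \<open>d\<close> cancels between \<open>B'\<close> and \<open>e\<close>; either
    \<open>B\<close> loses a dimension to \<open>p\<close>, or \<open>B \<inter> ann {p}\<close> is
    zero and \<open>c + 3 \<le> vec.dim H\<close> suffices.\<close>
  have "c - (CARD('n) - vec.dim ?L) + 3 \<le> vec.dim ?H"
    unfolding e' using cd e dimH bounds by linarith
  moreover have "vec.dim B' + (c - (CARD('n) - vec.dim ?L)) + 2 \<le> vec.dim ?H"
    unfolding e' using dimB' dimB e dimH bounds by linarith
  ultimately have new_bounds: "c - (CARD('n) - vec.dim ?L) + 3 \<le> vec.dim ?H"
    "vec.dim B' + (c - (CARD('n) - vec.dim ?L)) + 2 \<le> vec.dim ?H" .
  from IH[OF F' subB' B'H rc' codim(2) new_bounds]
  obtain y where y: "y \<in> ?H" "\<And>M. M \<in> S \<Longrightarrow> F' M - M *v y \<in> ann ?H" by blast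
  have "F M - M *v (x + y) = F' M - M *v y" for M
    by (simp add: F'_def matrix_vector_right_distrib)
  then show ?thesis using y x(1) vec.subspace_add[OF H, of x y] by (intro bexI[of _ "x + y"]) auto
qed

section \<open>Recovering vanishing from independent functionals\<close>

lemma mem_ann_if_mod_two:
  assumes "vec.subspace H" "\<And>c d. c *s p + d *s q \<in> ann H \<Longrightarrow> c = 0"
    and "f \<in> ann (H \<inter> ann {p})" "f \<in> ann (H \<inter> ann {q})"
  shows "f \<in> ann H"
proof -
  have mem: "\<exists>k. f - k *s r \<in> ann H" if fr: "f \<in> ann (H \<inter> ann {r})" for r
  proof -
    obtain k where "f - k *s r \<in> vec.span (ann H)"
      using fr unfolding ann_Int_hyperplane[OF assms(1)] vec.span_breakdown_eq by blast
    then have "f - k *s r \<in> ann H" by (simp add: vec.span_eq_iff[THEN iffD2])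
    then show ?thesis ..
  qed
  obtain k k' where k: "f - k *s p \<in> ann H" "f - k' *s q \<in> ann H"
    using mem[OF assms(3)] mem[OF assms(4)] by blast
  have "(f - k' *s q) - (f - k *s p) \<in> ann H"
    by (rule vec.subspace_diff[OF subspace_ann k(2,1)])
  moreover have "(f - k' *s q) - (f - k *s p) = k *s p + (- k') *s q" by simp
  ultimately have "k = 0" using assms(2)[of k "- k'"] by simp
  then show ?thesis using k(1) by simp
qed

lemma dual_vector:
  assumes "vec.subspace H" "\<And>c d. p - c *s q - d *s r \<notin> ann H"
  obtains u where "u \<in> H" "p \<cdot> u = 1" "q \<cdot> u = 0" "r \<cdot> u = 0"
proof -
  have "p \<notin> vec.span (insert q (insert r (ann H)))"
    using assms(2) by (auto simp: vec.span_breakdown_eq vec.span_eq_iff[THEN iffD2])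
  then obtain u where u: "u \<in> ann (vec.span (insert q (insert r (ann H))))" "u \<cdot> p = 1"
    by (rule separate_from_subspace[OF vec.subspace_span])
  then have "u \<in> ann (insert q (insert r (ann H)))" by (simp add: ann_span)
  then have "u \<in> ann (ann H)" "q \<cdot> u = 0" "r \<cdot> u = 0" by (auto simp: ann_def)
  then show thesis using that u assms(1) by (simp add: ann_ann dot_commute)
qed

text \<open>Additivity of \<open>F\<close> does not make its vanishing locus a \<open>mat.subspace\<close>; hence the detour
  through the matrices all of whose multiples lie in \<open>G\<close>.\<close>

lemma alternating_subset_if_generated:
  fixes H :: "('a::field^'n) set"
  assumes add: "\<And>M N. M \<in> G \<Longrightarrow> N \<in> G \<Longrightarrow> M + N \<in> G" and null: "null_on H \<subseteq> G"
    and span: "vec.span (P \<union> ann H) = UNIV"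
    and gens: "\<And>p q c. p \<in> P \<Longrightarrow> q \<in> P \<Longrightarrow> wedge p (c *s q) \<in> G"
  shows "alternating_mats \<subseteq> G"
proof -
  have zero: "0 \<in> G" using null mat.subspace_0[OF subspace_null_on] by blast
  have w0: "wedge p 0 = 0" "wedge 0 p = 0" for p :: "'a^'n"
    by (simp_all add: wedge_def vec_eq_iff)
  \<comment> \<open>The second factor is extended from \<open>P\<close> to the whole space first,
    then the first factor in \<open>step2\<close>.\<close>
  have step1: "wedge p q \<in> G" if p: "p \<in> P" for p q
  proof -
    have sub: "vec.subspace {q. \<forall>c. wedge p (c *s q) \<in> G}"
      using add zero w0 by (auto simp: vec.subspace_def wedge_linear_simps(1) vec.scale_right_distrib)
    have "P \<union> ann H \<subseteq> {q. \<forall>c. wedge p (c *s q) \<in> G}"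
      using gens p null wedge_null_on vec.subspace_scale[OF subspace_ann] by blast
    then have "vec.span (P \<union> ann H) \<subseteq> {q. \<forall>c. wedge p (c *s q) \<in> G}"
      using sub by (rule vec.span_minimal)
    then have "wedge p (1 *s q) \<in> G" unfolding span by blast
    then show ?thesis by simp
  qed
  have wz: "wedge z q \<in> null_on H" if "z \<in> ann H" for z q :: "'a^'n"
  proof -
    have "wedge z q = - wedge q z" by (simp add: wedge_def vec_eq_iff)
    moreover have "- wedge q z \<in> null_on H"
      by (rule mat.subspace_neg[OF subspace_null_on wedge_null_on[OF that]])
    ultimately show ?thesis by (rule ssubst)
  qed
  have step2: "wedge p q \<in> G" for p q
  proof -
    have sub: "vec.subspace {p. \<forall>c. wedge (c *s p) q \<in> G}"
      using add zero w0 by (auto simp: vec.subspace_def wedge_linear_simps(3) vec.scale_right_distrib)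
    have "wedge (c *s p) q = wedge p (c *s q)" for c p by (simp add: wedge_linear_simps)
    then have "P \<union> ann H \<subseteq> {p. \<forall>c. wedge (c *s p) q \<in> G}"
      using step1 null wz vec.subspace_scale[OF subspace_ann] by (auto simp del: wedge_linear_simps)
    then have "vec.span (P \<union> ann H) \<subseteq> {p. \<forall>c. wedge (c *s p) q \<in> G}"
      using sub by (rule vec.span_minimal)
    then have "wedge (1 *s p) q \<in> G" unfolding span by blast
    then show ?thesis by simp
  qed
  have "mat.subspace {M. \<forall>c. mat_scale c M \<in> G}"
    using add zero by (auto simp: mat.subspace_def mat.scale_right_distrib)
  moreover have "wedge p q \<in> {M. \<forall>c. mat_scale c M \<in> G}" for p q
    using step2[of p "_ *s q"] by (simp add: wedge_linear_simps)
  ultimately have "alternating_mats \<subseteq> {M. \<forall>c. mat_scale c M \<in> G}"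
    by (rule alternating_subset_if_wedges)
  then have "mat_scale 1 M \<in> G" if "M \<in> alternating_mats" for M using that by blast
  then show ?thesis by auto
qed

text \<open>Hyperplanes of \<open>H\<close> are too small for the induction, but every alternating
  form on \<open>H\<close> comes from \<open>S\<close>. One vector \<open>x\<close> absorbs the
  factors of three independent functionals at once. The wedge of two of them then maps to zero
  modulo either factor, hence modulo \<open>ann H\<close>, and such wedges generate
  everything.\<close>

lemma local_dim_3:
  fixes S :: "('a::field^'n^'n) set"
  assumes S: "mat.subspace S" "S \<subseteq> alternating_mats" and F: "additive_on S F"
    and H: "vec.subspace H" and B: "vec.subspace B"
    and rc: "range_compatible_off H B S F"
    and c: "mat.dim (alternating_mats :: ('a^'n^'n) set) \<le> mat.dim (extend_null H S) + 0"
    and bounds: "vec.dim H = 3" "vec.dim B + 0 + 2 \<le> vec.dim H"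
    and b: "b \<in> H" "b \<noteq> 0" "B \<subseteq> {0} \<or> b \<in> B"
  shows "\<exists>x\<in>H. \<forall>M\<in>S. F M - M *v x \<in> ann H"
proof -
  \<comment> \<open>Only nonvanishing at \<open>b\<close> is wanted, so \<open>b\<close> also takes
    the place of \<open>w\<close>; a second vector might not fit into dimension three.\<close>
  have "vec.dim {b, b} + 2 \<le> vec.dim H" using bounds b(2) by (simp add: vec.dim_insert)
  from three_functionals[OF b(2) b(2) b(1) b(1) this]
  obtain p1 p2 p3 where pb: "\<And>p. p \<in> {p1, p2, p3} \<Longrightarrow> p \<cdot> b \<noteq> 0"
    and ind: "\<And>c1 c2 c3. c1 *s p1 + c2 *s p2 + c3 *s p3 \<in> ann H \<Longrightarrow> c1 = 0 \<and> c2 = 0 \<and> c3 = 0"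
    by metis
  have "\<exists>l. \<forall>M q. M \<in> S \<longrightarrow> M - wedge p q \<in> null_on H \<longrightarrow> F M - l *s q \<in> ann (H \<inter> ann {p})"
    if p: "p \<in> {p1, p2, p3}" for p
  proof -
    have "p \<noteq> 0" "B \<subseteq> {0} \<or> (\<exists>b\<in>B. p \<cdot> b \<noteq> 0)" using pb[OF p] b(3) by auto
    from wedge_eigenvalue[OF S F H B rc c _ bounds(2) this] bounds(1) show ?thesis by force
  qed
  then obtain l where l: "\<And>p M q. p \<in> {p1, p2, p3} \<Longrightarrow> M \<in> S \<Longrightarrow> M - wedge p q \<in> null_on H
      \<Longrightarrow> F M - l p *s q \<in> ann (H \<inter> ann {p})" by metis
  have "p1 - c *s p2 - d *s p3 \<notin> ann H" for c d
    using ind[of 1 "- c" "- d"] by auto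
  from dual_vector[OF H this] obtain u1 where u1: "u1 \<in> H" "p1 \<cdot> u1 = 1" "p2 \<cdot> u1 = 0" "p3 \<cdot> u1 = 0" .
  have "p2 - c *s p1 - d *s p3 \<notin> ann H" for c d
    using ind[of "- c" 1 "- d"] by (auto simp: algebra_simps)
  from dual_vector[OF H this] obtain u2 where u2: "u2 \<in> H" "p2 \<cdot> u2 = 1" "p1 \<cdot> u2 = 0" "p3 \<cdot> u2 = 0" .
  have "p3 - c *s p1 - d *s p2 \<notin> ann H" for c d
    using ind[of "- c" "- d" 1] by (auto simp: algebra_simps)
  from dual_vector[OF H this] obtain u3 where u3: "u3 \<in> H" "p3 \<cdot> u3 = 1" "p1 \<cdot> u3 = 0" "p2 \<cdot> u3 = 0" .
  \<comment> \<open>\<open>u1\<close>, \<open>u2\<close>, \<open>u3\<close> are dual to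
    \<open>p1\<close>, \<open>p2\<close>, \<open>p3\<close>, so all three factors can be
    prescribed.\<close>
  define x where "x = (- l p1) *s u1 + (- l p2) *s u2 + (- l p3) *s u3"
  have xH: "x \<in> H" unfolding x_def
    by (intro vec.subspace_add[OF H] vec.subspace_scale[OF H] u1 u2 u3)
  have px: "p \<cdot> x = - l p" if "p \<in> {p1, p2, p3}" for p
    using that u1 u2 u3 by (auto simp: x_def)
  define F' where "F' = (\<lambda>M. F M - M *v x)"
  have F': "additive_on S F'" unfolding F'_def by (rule additive_on_subtract_local[OF F])
  have wedges: "F' M \<in> ann (H \<inter> ann {p})"
    if p: "p \<in> {p1, p2, p3}" and M: "M \<in> S" "M - wedge p q \<in> null_on H" for p q M
  proof -
    have "(M - wedge p q) *v x \<in> ann H" by (rule null_mult[OF M(2) xH])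
    then have 1: "(M - wedge p q) *v x \<in> ann (H \<inter> ann {p})" by (auto simp: ann_def)
    have 2: "(q \<cdot> x) *s p \<in> ann (H \<inter> ann {p})" by (auto simp: ann_def dot_commute)
    have "F' M = (F M - l p *s q) - ((M - wedge p q) *v x) - (q \<cdot> x) *s p"
      by (simp add: F'_def matrix_vector_mult_diff_rdistrib wedge_mult px[OF p])
    also have "\<dots> \<in> ann (H \<inter> ann {p})"
      by (intro vec.subspace_diff[OF subspace_ann] l[OF p M] 1 2)
    finally show ?thesis .
  qed
  \<comment> \<open>\<open>F'\<close> is controlled only on \<open>S\<close>, so vanishing is
    required for every representative \<open>N\<close> in \<open>S\<close> of the form that
    \<open>M\<close> induces on \<open>H\<close>; \<open>approx\<close> supplies one.\<close>
  define G where "G = {M \<in> alternating_mats. \<forall>N\<in>S. N - M \<in> null_on H \<longrightarrow> F' N \<in> ann H}"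
  have T: "extend_null H S = alternating_mats"
    by (rule mat.subspace_dim_equal[OF subspace_extend_null[OF S(1)] subspace_alternating
          extend_null_alternating[OF S(2)]]) (use c in simp)
  have approx: "\<exists>N\<in>S. N - M \<in> null_on H" if "M \<in> alternating_mats" for M
  proof -
    have "M \<in> extend_null H S" using that T by simp
    then obtain N E where "M = N + E" "N \<in> S" "E \<in> null_on H" by (auto simp: extend_null_def)
    then show ?thesis using mat.subspace_neg[OF subspace_null_on, of E H] by (intro bexI[of _ N]) auto
  qed
  have "p1 \<noteq> p2"
    using ind[of 1 "- 1" 0] vec.subspace_0[OF subspace_ann, of H] by auto
  have cross: "f \<in> ann H" if "p \<in> {p1, p2, p3}" "q \<in> {p1, p2, p3}" "p \<noteq> q"
    "f \<in> ann (H \<inter> ann {p})" "f \<in> ann (H \<inter> ann {q})" for f p q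
  proof (rule mem_ann_if_mod_two[OF H _ that(4,5)])
    fix c d assume "c *s p + d *s q \<in> ann H"
    then show "c = 0"
      using that(1-3) ind[of c d 0] ind[of c 0 d] ind[of d c 0] ind[of 0 c d] ind[of d 0 c] ind[of 0 d c]
      by (auto simp: add.commute)
  qed
  have nullG: "F' N \<in> ann H" if "N \<in> S" "N \<in> null_on H" for N
  proof (rule cross[OF _ _ \<open>p1 \<noteq> p2\<close>])
    have "wedge p 0 = 0" for p :: "'a^'n" by (simp add: wedge_def vec_eq_iff)
    then show "F' N \<in> ann (H \<inter> ann {p1})" "F' N \<in> ann (H \<inter> ann {p2})"
      using wedges[of p1 N 0] wedges[of p2 N 0] that by auto
  qed auto
  have "alternating_mats \<subseteq> G"
  proof (rule alternating_subset_if_generated[of G H "{p1, p2, p3}"])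
    fix M N assume MN: "M \<in> G" "N \<in> G"
    show "M + N \<in> G"
      unfolding G_def
    proof (intro CollectI conjI ballI impI)
      show "M + N \<in> alternating_mats"
        using MN mat.subspace_add[OF subspace_alternating] by (auto simp: G_def)
      fix K assume K: "K \<in> S" "K - (M + N) \<in> null_on H"
      obtain M' where M': "M' \<in> S" "M' - M \<in> null_on H" using approx[of M] MN by (auto simp: G_def)
      have "K - M' \<in> S" using K M' S by (simp add: mat.subspace_diff)
      moreover have "(K - (M + N)) - (M' - M) \<in> null_on H"
        by (rule mat.subspace_diff[OF subspace_null_on K(2) M'(2)])
      then have "(K - M') - N \<in> null_on H" by (simp add: algebra_simps)
      ultimately have "F' (K - M') \<in> ann H" "F' M' \<in> ann H" using MN M' by (auto simp: G_def)
      then have "F' M' + F' (K - M') \<in> ann H" by (intro vec.subspace_add[OF subspace_ann])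
      moreover have "F' M' + F' (K - M') = F' (M' + (K - M'))"
        using F' M'(1) \<open>K - M' \<in> S\<close> unfolding additive_on_def by metis
      ultimately show "F' K \<in> ann H" by simp
    qed
  next
    show "null_on H \<subseteq> G"
    proof
      fix M assume M: "M \<in> null_on H"
      have "F' N \<in> ann H" if "N \<in> S" "N - M \<in> null_on H" for N
        using mat.subspace_add[OF subspace_null_on that(2) M] nullG[OF that(1)] by simp
      moreover have "M \<in> alternating_mats" using M by (simp add: null_on_def)
      ultimately show "M \<in> G" unfolding G_def by blast
    qed
  next
    have 3: "p3 \<notin> vec.span (ann H)" using ind[of 0 0 1] by (auto simp: vec.span_eq_iff[THEN iffD2])
    have 2: "p2 \<notin> vec.span (insert p3 (ann H))"
      using ind[of 0 1 "- _"] by (auto simp: vec.span_breakdown_eq vec.span_eq_iff[THEN iffD2])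
    have 1: "p1 \<notin> vec.span (insert p2 (insert p3 (ann H)))"
      using ind[of 1 "- _" "- _"] by (auto simp: vec.span_breakdown_eq vec.span_eq_iff[THEN iffD2])
    have "vec.dim ({p1, p2, p3} \<union> ann H) = vec.dim (ann H) + 3"
      using 1 2 3 by (simp add: vec.dim_insert)
    then have "vec.dim ({p1, p2, p3} \<union> ann H) = CARD('n)" using dim_ann[of H] bounds by simp
    then show "vec.span ({p1, p2, p3} \<union> ann H) = UNIV"
      using vec.dim_eq_full[of "{p1, p2, p3} \<union> ann H"] by (simp add: card_cart_basis vec.dimension_def)
  next
    fix p q c assume pq: "p \<in> {p1, p2, p3}" "q \<in> {p1, p2, p3}"
    show "wedge p (c *s q) \<in> G"
      unfolding G_def
    proof (intro CollectI conjI ballI impI wedge_alternating)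
      fix N assume N: "N \<in> S" "N - wedge p (c *s q) \<in> null_on H"
      show "F' N \<in> ann H"
      proof (cases "p = q")
        case True
        have "wedge p (c *s q) = 0" by (simp add: True wedge_def vec_eq_iff)
        then show ?thesis using N nullG by simp
      next
        case False
        have "wedge p (c *s q) = wedge q ((- c) *s p)" by (simp add: wedge_def vec_eq_iff)
        then show ?thesis using cross[OF pq False] wedges[OF pq(1) N] wedges[OF pq(2) N(1)] N(2) by metis
      qed
    qed
  qed
  then have "F' M \<in> ann H" if "M \<in> S" for M
    using that S(2) mat.subspace_0[OF subspace_null_on, of H] by (auto simp: G_def)
  then show ?thesis using xH unfolding F'_def by blast
qed

text \<open>The generalisation that survives induction on \<open>vec.dim H\<close>: \<open>S\<close>
  stays fixed while \<open>F\<close>, \<open>H\<close>, \<open>B\<close> and \<open>c\<close> vary.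
  Above dimension three, local models modulo three functionals come from hyperplanes and are
  compared.\<close>

lemma local_mod_ann:
  fixes S :: "('a::field^'n^'n) set"
  assumes S: "mat.subspace S" "S \<subseteq> alternating_mats"
  shows "\<lbrakk>additive_on S F; vec.subspace H; vec.subspace B; B \<subseteq> H; range_compatible_off H B S F;
    mat.dim (alternating_mats :: ('a^'n^'n) set) \<le> mat.dim (extend_null H S) + c;
    c + 3 \<le> vec.dim H; vec.dim B + c + 2 \<le> vec.dim H\<rbrakk>
    \<Longrightarrow> \<exists>x\<in>H. \<forall>M\<in>S. F M - M *v x \<in> ann H"
proof (induction "vec.dim H" arbitrary: F H B c rule: less_induct)
  case less
  note F = less.prems(1) and H = less.prems(2) and B = less.prems(3,4) and rc = less.prems(5)
  let ?A = "alternating_mats :: ('a^'n^'n) set" and ?T = "extend_null H S" and ?Z = "ann H"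
  have T: "mat.subspace ?T" "?T \<subseteq> ?A" using S extend_null_alternating by auto
  \<comment> \<open>\<open>c\<close> is only a bound; the choice of \<open>w\<close> below needs the exact codimension.\<close>
  define e where "e = mat.dim ?A - mat.dim ?T"
  have e: "mat.dim ?A \<le> mat.dim ?T + e" by (simp add: e_def)
  have bounds: "e + 3 \<le> vec.dim H" "vec.dim B + e + 2 \<le> vec.dim H"
    using less.prems(6-8) by (auto simp: e_def)
  have "\<not> H \<subseteq> {0}"
  proof
    assume "H \<subseteq> {0}"
    then have "vec.dim H = 0" by (simp add: vec.dim_eq_0)
    then show False using bounds by linarith
  qed
  \<comment> \<open>Taken from \<open>B\<close> whenever possible, so that a functional nonzero at
    \<open>b\<close> cuts \<open>B\<close> down.\<close>
  then obtain b where b: "b \<in> H" "b \<noteq> 0" "B \<subseteq> {0} \<or> b \<in> B"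
    using B(2) by (cases "B \<subseteq> {0}") auto
  show ?case
  proof (cases "vec.dim H = 3")
    case True
    then have "e = 0" using bounds by simp
    then show ?thesis using local_dim_3[OF S F H B(1) rc _ True _ b] e bounds by simp
  next
    case False
    then have h4: "4 \<le> vec.dim H" using bounds by simp
    \<comment> \<open>A functional nonzero at \<open>w\<close> makes a positive codimension drop
      strictly.\<close>
    obtain w where w: "w \<in> H" "w \<noteq> 0" "\<And>p. p \<cdot> w \<noteq> 0 \<Longrightarrow> e = 0 \<or> wedge_partners H S p \<noteq> UNIV"
    proof (cases "e = 0")
      case True
      then show thesis using that b by blast
    next
      case False
      \<comment> \<open>\<open>R\<close> collects the functionals to be avoided. It is a proper
        subspace because wedges generate all alternating matrices, so some nonzero \<open>w\<close>
        annihilates it.\<close>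
      define R where "R = {p. \<forall>q. wedge p q \<in> ?T}"
      have w0: "wedge 0 q = 0" for q :: "'a^'n" by (simp add: wedge_def vec_eq_iff)
      have R: "vec.subspace R"
        unfolding R_def by (intro vec.subspaceI)
          (simp_all add: w0 wedge_linear_simps mat.subspace_0[OF T(1)] mat.subspace_add[OF T(1)] mat.subspace_scale[OF T(1)])
      have "R \<noteq> UNIV"
      proof
        assume "R = UNIV"
        then have "wedge p q \<in> ?T" for p q by (auto simp: R_def)
        then have "?A \<subseteq> ?T" by (rule alternating_subset_if_wedges[OF T(1)])
        then show False using False mat.dim_subset[of ?A ?T] by (simp add: e_def)
      qed
      then obtain v where "v \<notin> R" by blast
      then obtain w where w: "w \<in> ann R" "w \<cdot> v = 1" by (rule separate_from_subspace[OF R])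
      have "?Z \<subseteq> R"
      proof
        fix z assume "z \<in> ?Z"
        then have "- wedge q z \<in> ?T" for q
          using null_subset_extend_null[OF S(1)] mat.subspace_neg[OF T(1)] wedge_null_on[of z H q] by blast
        moreover have "wedge z q = - wedge q z" for q by (simp add: wedge_def vec_eq_iff)
        ultimately show "z \<in> R" by (simp add: R_def)
      qed
      then have "w \<in> ann ?Z" using w by (auto simp: ann_def)
      then have "w \<in> H" by (simp add: ann_ann H)
      moreover have "wedge_partners H S p \<noteq> UNIV" if "p \<cdot> w \<noteq> 0" for p
      proof
        assume "wedge_partners H S p = UNIV"
        then have "p \<in> R" by (auto simp: wedge_partners_def R_def)
        then show False using w that by (auto simp: ann_def)
      qed
      moreover have "w \<noteq> 0" using w by auto
      ultimately show thesis using that by blast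
    qed
    have "vec.dim {b, w} \<le> 2" by (simp add: vec.dim_insert)
    then have "vec.dim {b, w} + 2 \<le> vec.dim H" using h4 by linarith
    from three_functionals[OF b(2) w(2) b(1) w(1) this]
    obtain p1 p2 p3 where pbw: "\<And>p. p \<in> {p1, p2, p3} \<Longrightarrow> p \<cdot> b \<noteq> 0 \<and> p \<cdot> w \<noteq> 0"
      and ind: "\<And>c1 c2 c3. c1 *s p1 + c2 *s p2 + c3 *s p3 \<in> ?Z \<Longrightarrow> c1 = 0 \<and> c2 = 0 \<and> c3 = 0"
      by blast
    have model: "\<exists>x\<in>H. \<forall>M\<in>S. F M - M *v x \<in> ann (H \<inter> ann {p})" if p: "p \<in> {p1, p2, p3}" for p
    proof (rule local_mod_functional[OF S F H B rc e bounds h4 b(1) _ b(3)])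
      show "p \<cdot> b \<noteq> 0" "e = 0 \<or> wedge_partners H S p \<noteq> UNIV" using pbw[OF p] w(3) by auto
      have "vec.dim (H \<inter> ann {p}) < vec.dim H"
        using dim_hyperplane_section[OF H b(1), of p] pbw[OF p] by simp
      moreover have "vec.subspace (H \<inter> ann {p})" using H by (simp add: vec.subspace_inter)
      ultimately show "\<exists>x\<in>H \<inter> ann {p}. \<forall>M\<in>S. F M - M *v x \<in> ann (H \<inter> ann {p})"
        if "additive_on S F" "vec.subspace B'" "B' \<subseteq> H \<inter> ann {p}"
          "range_compatible_off (H \<inter> ann {p}) B' S F"
          "mat.dim ?A \<le> mat.dim (extend_null (H \<inter> ann {p}) S) + c'"
          "c' + 3 \<le> vec.dim (H \<inter> ann {p})" "vec.dim B' + c' + 2 \<le> vec.dim (H \<inter> ann {p})" for F B' c'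
        using less.hyps[of "H \<inter> ann {p}" F B' c'] that by blast
    qed
    then obtain x where x: "\<And>p. p \<in> {p1, p2, p3} \<Longrightarrow> x p \<in> H"
      "\<And>p M. p \<in> {p1, p2, p3} \<Longrightarrow> M \<in> S \<Longrightarrow> F M - M *v x p \<in> ann (H \<inter> ann {p})"
      by metis
    \<comment> \<open>The models for \<open>p\<close> and \<open>p1\<close> are exact modulo
      \<open>p\<close> and \<open>p1\<close> respectively, so evaluation at their difference lands
      in \<open>P p\<close>.\<close>
    define P where "P p = vec.span (insert p (insert p1 ?Z))" for p
    have dim_P: "vec.dim (P p) \<le> CARD('n) - vec.dim H + 2" for p
    proof -
      have "vec.dim (P p) \<le> vec.dim ?Z + 2" unfolding P_def by (simp add: vec.dim_insert)
      then show ?thesis using dim_ann[of H] by linarith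
    qed
    have diff: "M *v (x p - x p1) \<in> P p" if p: "p \<in> {p1, p2, p3}" and M: "M \<in> ?T" for p M
    proof -
      obtain M0 N where N: "M = M0 + N" "M0 \<in> S" "N \<in> null_on H"
        using M by (auto simp: extend_null_def)
      have le: "ann (H \<inter> ann {r}) \<subseteq> P p" if "r \<in> {p, p1}" for r
        unfolding ann_Int_hyperplane[OF H] P_def using that by (intro vec.span_mono) auto
      have "N *v (x p - x p1) \<in> ?Z"
        using x(1) p by (intro null_mult[OF N(3)] vec.subspace_diff[OF H]) auto
      then have 0: "N *v (x p - x p1) \<in> P p" unfolding P_def by (intro vec.span_base) simp
      have 1: "F M0 - M0 *v x p1 \<in> P p" using x(2)[of p1, OF _ N(2)] le[of p1] by blast
      have 2: "F M0 - M0 *v x p \<in> P p" using x(2)[of p, OF p N(2)] le[of p] by blast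
      have "M *v (x p - x p1) = (F M0 - M0 *v x p1) - (F M0 - M0 *v x p) + N *v (x p - x p1)"
        by (simp add: N(1) matrix_vector_mult_add_rdistrib matrix_vector_mult_diff_distrib)
      also have "\<dots> \<in> P p"
        using 0 1 2 unfolding P_def by (metis vec.span_add vec.span_diff)
      finally show ?thesis .
    qed
    have "P p2 \<inter> P p3 \<subseteq> vec.span (insert p1 ?Z)"
    proof
      fix f assume "f \<in> P p2 \<inter> P p3"
      then obtain k2 k3 where k2: "f - k2 *s p2 \<in> vec.span (insert p1 ?Z)"
        and k3: "f - k3 *s p3 \<in> vec.span (insert p1 ?Z)"
        unfolding P_def Int_iff vec.span_breakdown_eq[of f] by blast
      have "(f - k3 *s p3) - (f - k2 *s p2) \<in> vec.span (insert p1 ?Z)"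
        by (rule vec.span_diff[OF k3 k2])
      then obtain k where "(f - k3 *s p3) - (f - k2 *s p2) - k *s p1 \<in> vec.span ?Z"
        unfolding vec.span_breakdown_eq by blast
      moreover have "(f - k3 *s p3) - (f - k2 *s p2) - k *s p1 = (- k) *s p1 + k2 *s p2 + (- k3) *s p3"
        by simp
      ultimately have "(- k) *s p1 + k2 *s p2 + (- k3) *s p3 \<in> ?Z"
        by (simp only: vec.span_eq_iff[THEN iffD2, OF subspace_ann])
      then have "k2 = 0" using ind by blast
      then show "f \<in> vec.span (insert p1 ?Z)"
        using k2 by simp
    qed
    then have "vec.dim (P p2 \<inter> P p3) \<le> vec.dim (vec.span (insert p1 ?Z))" by (rule vec.dim_subset)
    also have "\<dots> \<le> CARD('n) - vec.dim H + 1" by (rule dim_insert_ann)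
    finally have dim_Int: "vec.dim (P p2 \<inter> P p3) \<le> CARD('n) - vec.dim H + 1" .
    have "vec.dim H \<le> CARD('n)" using dim_ann[of H] by linarith
    moreover have "M *v (x p2 - x p1) \<in> P p2" "M *v (x p3 - x p1) \<in> P p3" if "M \<in> ?T" for M
      using diff that by auto
    moreover have "vec.subspace (P p)" for p by (simp add: P_def)
    ultimately have "x p2 - x p1 = 0 \<or> x p3 - x p1 = 0"
      using local_models_agree[OF T e bounds(1) h4 _ _ _ dim_P dim_P dim_Int, of "x p2 - x p1" "x p3 - x p1"]
      by blast
    \<comment> \<open>The model for \<open>p1\<close> is thus exact modulo two independent
      functionals, hence modulo \<open>ann H\<close>.\<close>
    then obtain p where p: "p \<in> {p2, p3}" "x p = x p1" by auto
    have "F M - M *v x p1 \<in> ?Z" if "M \<in> S" for M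
    proof (rule mem_ann_if_mod_two[OF H, of p1 p])
      fix c d assume "c *s p1 + d *s p \<in> ?Z"
      then show "c = 0" using p(1) ind[of c d 0] ind[of c 0 d] by auto
    next
      show "F M - M *v x p1 \<in> ann (H \<inter> ann {p1})" using x(2)[of p1 M] that by simp
      show "F M - M *v x p1 \<in> ann (H \<inter> ann {p})" using x(2)[of p M] that p by auto
    qed
    then show ?thesis using x(1) by blast
  qed
qed

section \<open>Specialisation to the whole space without exceptions\<close>

theorem theorem1p7:
  fixes S :: "('a::field^'n^'n) set" and F :: "'a^'n^'n \<Rightarrow> 'a^'n"
  assumes "mat.subspace S"
    and "S \<subseteq> alternating_mats"
    and "alt_codim S \<le> int CARD('n) - 3"
    and "additive_on S F"
    and "range_compatible S F"
  shows "local_on S F"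
proof -
  let ?A = "alternating_mats :: ('a^'n^'n) set"
  have ann_UNIV: "ann (UNIV :: ('a^'n) set) = {0}"
  proof -
    have "vec.dim (ann (UNIV :: ('a^'n) set)) = 0"
      using dim_ann[of "UNIV :: ('a^'n) set"] by (simp add: card_cart_basis)
    then show ?thesis using vec.subspace_0[OF subspace_ann] by (auto simp: vec.dim_eq_0)
  qed
  \<comment> \<open>No truncation occurs here since \<open>S\<close> consists of alternating
    matrices; the integer bound then also gives \<open>3 \<le> CARD('n)\<close>.\<close>
  define c where "c = mat.dim ?A - mat.dim S"
  have "mat.dim S \<le> mat.dim ?A" using assms(2) by (rule mat.dim_subset)
  then have c: "c + 3 \<le> CARD('n)" "mat.dim ?A \<le> mat.dim S + c"
    using assms(3) by (auto simp: c_def alt_codim_def)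
  have "S \<subseteq> extend_null UNIV S"
    using mat.subspace_0[OF subspace_null_on] by (force simp: extend_null_def)
  then have "mat.dim S \<le> mat.dim (extend_null UNIV S)" by (rule mat.dim_subset)
  moreover have "range_compatible_off UNIV {0} S F"
    unfolding range_compatible_off_def
  proof (intro ballI impI)
    fix M u assume M: "M \<in> S" and "M *v u \<in> ann (UNIV :: ('a^'n) set)"
    then have "M *v u = 0" by (simp add: ann_UNIV)
    moreover obtain X where "F M = M *v X" using assms(5) M by (auto simp: range_compatible_def)
    ultimately show "u \<cdot> F M = 0"
      using alternating_skew[of M u X] M assms(2) by auto
  qed
  moreover have "vec.dim (UNIV :: ('a^'n) set) = CARD('n)" by (simp add: card_cart_basis)
  ultimately have "\<exists>x\<in>UNIV. \<forall>M\<in>S. F M - M *v x \<in> ann (UNIV :: ('a^'n) set)"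
    using c by (intro local_mod_ann[OF assms(1,2,4), of _ "{0}" c]) auto
  then show ?thesis by (simp add: ann_UNIV local_on_def)
qed

end
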